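(* For every $n\ge k$, $\beta\in\mathbb{R}^k$, $\sigma>0$, the distribution of $\sqrt n(\tilde\beta-\beta)$ under $\mathbb{P}_{n,\beta,\sigma}$ has a Lebesgue density $f_{n,\beta,\sigma}$ on $\mathbb{R}^k$ given as follows. Write $t=(t_1',t_2')'$ with $t_1\in\mathbb{R}^{k_1}$, $t_2\in\mathbb{R}^{k_2}$, let $D_{n2}=(X_2'(I-P_R)X_2)^{-1/2}$, $w=w(t_2)=n^{-1/2}D_{n2}^{-1}(t_2+n^{1/2}\beta_2)$ and $G=g(\|w\|)$. Then $$f_{n,\beta,\sigma}(t)=(2\pi\sigma^2)^{-k/2}[\det(X'X/n)]^{1/2}\exp\Big(-\tfrac{1}{2\sigma^2}\big\|n^{-1/2}(X_1'X_1)^{1/2}t_1+n^{-1/2}(X_1'X_1)^{-1/2}X_1'X_2t_2\big\|^2\Big)$$ $$\times\big[1+\exp(-\alpha\sigma^{-2}G^2+2\alpha k_2)\big]^{k_2}\Big\{1+2\alpha\sigma^{-2}G^2\big[1+\exp(\alpha\sigma^{-2}G^2-2\alpha k_2)\big]^{-1}\Big\}^{-1}\exp\Big(-\tfrac{1}{2\sigma^2}\big\|G\,w/\|w\|-D_{n2}^{-1}\beta_2\big\|^2\Big),$$ with the convention $G\,w/\|w\|=0$ when $w=0$.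
   Context: Setup: for each sample size $n$, $Y=X\beta+u$, where $Y$ is $n\times1$, $X$ is a non-stochastic $n\times k$ matrix of full column rank $k$ (so $n\ge k$), $k>1$, and $u\sim N(0,\sigma^2I_n)$ with $0<\sigma^2<\infty$ known. $\mathbb{P}_{n,\beta,\sigma}$ denotes the distribution of $Y$. Partition $X=[X_1:X_2]$ and $\beta=(\beta_1',\beta_2')'$ commensurably, with $X_i$ having $k_i\ge1$ columns. $\hat\beta(R)=\big(((X_1'X_1)^{-1}X_1'Y)',0_{1\times k_2}\big)'$, $\hat\beta(U)=(X'X)^{-1}X'Y$. For $\alpha>0$, $\tilde\beta=\hat\lambda\hat\beta(R)+(1-\hat\lambda)\hat\beta(U)$ with $\hat\lambda=\big[1+\exp(-2\alpha k_2)\exp(\alpha\|X\hat\beta(R)-X\hat\beta(U)\|^2/\sigma^2)\big]^{-1}$. $P_R=X_1(X_1'X_1)^{-1}X_1'$; $A^{1/2}$ is the symmetric positive definite root. Function $g$: with $a=\exp(2\alpha k_2)$ and $b=\sigma^2/\alpha$, let $h:[0,\infty)\to[0,\infty)$, $h(\xi)=[1+a\exp(-\xi^2/b)]^{-1}\xi$; $h$ is a continuous strictly increasing bijection of $[0,\infty)$ and $g$ is its inverse. *)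

theory Defs
  imports "HOL-Analysis.Analysis" "HOL-Probability.Probability"
begin

text \<open>Matrices are HOL-Analysis matrices. The regressor index set is the
sum type 'k1 + 'k2, so X = [X1 : X2] with k1 = CARD('k1), k2 = CARD('k2) columns;
the sample size is n = CARD('n).\<close>

definition psd_sqrt :: "real^'m::finite^'m \<Rightarrow> real^'m^'m" where
  "psd_sqrt A = (THE B. transpose B = B \<and> (\<forall>x. x \<noteq> 0 \<longrightarrow> 0 < x \<bullet> (B *v x)) \<and> B ** B = A)"

definition blk1 :: "real^('k1::finite+'k2::finite)^'n::finite \<Rightarrow> real^'k1^'n" where
  "blk1 X = (\<chi> i j. X $ i $ Inl j)"

definition blk2 :: "real^('k1::finite+'k2::finite)^'n::finite \<Rightarrow> real^'k2^'n" where
  "blk2 X = (\<chi> i j. X $ i $ Inr j)"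

definition vpart1 :: "real^('k1::finite+'k2::finite) \<Rightarrow> real^'k1" where
  "vpart1 t = (\<chi> j. t $ Inl j)"

definition vpart2 :: "real^('k1::finite+'k2::finite) \<Rightarrow> real^'k2" where
  "vpart2 t = (\<chi> j. t $ Inr j)"

text \<open>Distribution P_{n,beta,sigma} of Y = X beta + u, u ~ N(0, sigma^2 I_n).\<close>
definition model_distr :: "real^('k1::finite+'k2::finite)^'n::finite \<Rightarrow> real^('k1::finite+'k2::finite) \<Rightarrow> real \<Rightarrow> (real^'n::finite) measure" where
  "model_distr X \<beta> \<sigma> = density lborel (\<lambda>y. ennreal ((2 * pi * \<sigma>\<^sup>2) powr (- real CARD('n) / 2)
      * exp (- (norm (y - X *v \<beta>))\<^sup>2 / (2 * \<sigma>\<^sup>2))))"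

definition beta_R :: "real^('k1::finite+'k2::finite)^'n::finite \<Rightarrow> real^'n::finite \<Rightarrow> real^('k1::finite+'k2::finite)" where
  "beta_R X Y = (let b1 = matrix_inv (transpose (blk1 X) ** blk1 X) *v (transpose (blk1 X) *v Y)
     in (\<chi> i. case i of Inl j \<Rightarrow> b1 $ j | Inr j \<Rightarrow> 0))"

definition beta_U :: "real^('k1::finite+'k2::finite)^'n::finite \<Rightarrow> real^'n::finite \<Rightarrow> real^('k1::finite+'k2::finite)" where
  "beta_U X Y = matrix_inv (transpose X ** X) *v (transpose X *v Y)"

definition lambda_hat :: "real \<Rightarrow> real \<Rightarrow> real^('k1::finite+'k2::finite)^'n::finite \<Rightarrow> real^'n::finite \<Rightarrow> real" where
  "lambda_hat \<alpha> \<sigma> X Y = inverse (1 + exp (- 2 * \<alpha> * real CARD('k2))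
      * exp (\<alpha> * (norm (X *v beta_R X Y - X *v beta_U X Y))\<^sup>2 / \<sigma>\<^sup>2))"

definition beta_tilde :: "real \<Rightarrow> real \<Rightarrow> real^('k1::finite+'k2::finite)^'n::finite \<Rightarrow> real^'n::finite \<Rightarrow> real^('k1::finite+'k2::finite)" where
  "beta_tilde \<alpha> \<sigma> X Y = lambda_hat \<alpha> \<sigma> X Y *\<^sub>R beta_R X Y + (1 - lambda_hat \<alpha> \<sigma> X Y) *\<^sub>R beta_U X Y"

definition h_fun :: "real \<Rightarrow> real \<Rightarrow> real \<Rightarrow> real" where
  "h_fun a b \<xi> = inverse (1 + a * exp (- \<xi>\<^sup>2 / b)) * \<xi>"

definition g_fun :: "real \<Rightarrow> real \<Rightarrow> real \<Rightarrow> real" where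
  "g_fun a b y = (THE \<xi>. 0 \<le> \<xi> \<and> h_fun a b \<xi> = y)"

definition dens :: "real \<Rightarrow> real \<Rightarrow> real^('k1::finite+'k2::finite)^'n::finite \<Rightarrow> real^('k1::finite+'k2::finite) \<Rightarrow> real^('k1::finite+'k2::finite) \<Rightarrow> real" where
  "dens \<alpha> \<sigma> X \<beta> t = (let
      n = real CARD('n); k = real CARD('k1+'k2); k2 = CARD('k2);
      X1 = blk1 X; X2 = blk2 X; t1 = vpart1 t; t2 = vpart2 t; \<beta>2 = vpart2 \<beta>;
      S1 = transpose X1 ** X1;
      PR = X1 ** matrix_inv S1 ** transpose X1;
      Dinv = psd_sqrt (transpose X2 ** (mat 1 - PR) ** X2);
      w = (1 / sqrt n) *\<^sub>R (Dinv *v (t2 + sqrt n *\<^sub>R \<beta>2));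
      G = g_fun (exp (2 * \<alpha> * real k2)) (\<sigma>\<^sup>2 / \<alpha>) (norm w);
      Gw = (if w = 0 then 0 else (G / norm w) *\<^sub>R w)
    in (2 * pi * \<sigma>\<^sup>2) powr (- k / 2) * sqrt (det ((1 / n) *\<^sub>R (transpose X ** X)))
       * exp (- (norm ((1 / sqrt n) *\<^sub>R (psd_sqrt S1 *v t1)
                 + (1 / sqrt n) *\<^sub>R (matrix_inv (psd_sqrt S1) *v (transpose X1 *v (X2 *v t2)))))\<^sup>2
              / (2 * \<sigma>\<^sup>2))
       * (1 + exp (- \<alpha> / \<sigma>\<^sup>2 * G\<^sup>2 + 2 * \<alpha> * real k2)) ^ k2
       * inverse (1 + 2 * \<alpha> / \<sigma>\<^sup>2 * G\<^sup>2 * inverse (1 + exp (\<alpha> / \<sigma>\<^sup>2 * G\<^sup>2 - 2 * \<alpha> * real k2)))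
       * exp (- (norm (Gw - Dinv *v \<beta>2))\<^sup>2 / (2 * \<sigma>\<^sup>2)))"

end

theory Submission
  imports Defs
begin

text \<open>
  Let \<open>B\<close> be the block triangular square root of \<open>X'X\<close> that sends \<open>u\<close> to
  \<open>((X1'X1)^(1/2) (u1 + A u2), (X2'(I - P_R)X2)^(1/2) u2)\<close> with \<open>A = (X1'X1)^(-1) X1'X2\<close>. Then
  \<open>z = B beta_U = L Y\<close> with \<open>L L' = I\<close>, so \<open>z\<close> is Gaussian with mean \<open>B \<beta>\<close> and
  covariance \<open>\<sigma>\<^sup>2 I\<close>, and in these coordinates model averaging leaves the first block alone and
  shrinks the second one radially: \<open>B beta_tilde = (z1, s(|z2|\<^sup>2) z2)\<close>, where \<open>s(r) = 1/(1 + a exp(-r/b))\<close>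
  and \<open>h(\<xi>) = s(\<xi>\<^sup>2) \<xi>\<close>. The density is the change of variables formula for this map; its Jacobian is
  the determinant of a diagonal matrix times a rank one perturbation of the identity.
\<close>

text \<open>The triangular root is chosen over the symmetric root of \<open>X'X\<close> because it
  also turns the restriction into a coordinate truncation: \<open>B beta_R = (z1, 0)\<close>, so
  \<open>|X beta_R - X beta_U| = |z2|\<close> and the weight depends on the second block alone.
  Writing the weight as a function \<open>s\<close> of the squared radius makes the shrinkage
  differentiable at the origin too, so no exceptional point has to be removed. The density identity
  is checked at image points only. There \<open>g\<close> cancels against \<open>h\<close>, and
  beyond that only measurability of \<open>g\<close> is used. With \<open>E = a exp(-r/b)\<close>
  one has \<open>s = 1/(1 + E)\<close> and \<open>s' = s\<^sup>2 E / b\<close>, so the Jacobian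
  determinant of the shrinkage is \<open>s^k2 (1 + 2 s E r / b)\<close>. Its reciprocal gives the
  two bracketed factors of the density; the determinant of \<open>X'X/n\<close> comes from undoing
  \<open>B\<close> and rescaling.\<close>

subsection \<open>Change of variables for densities\<close>

text \<open>The library states the change of variables theorem only for well-ordered index types,
  which sums of finite types are not; this type supplies a well-ordered copy of any finite type.\<close>

typedef ('m::finite) idx = "{..<CARD('m)}"
  by (auto intro!: exI[of _ 0])

instantiation idx :: (finite) "{finite,wellorder}"
begin
definition less_eq_idx :: "'a idx \<Rightarrow> 'a idx \<Rightarrow> bool" where "less_eq_idx i j \<longleftrightarrow> Rep_idx i \<le> Rep_idx j"
definition less_idx :: "'a idx \<Rightarrow> 'a idx \<Rightarrow> bool" where "less_idx i j \<longleftrightarrow> Rep_idx i < Rep_idx j"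
instance
proof
  show "finite (UNIV :: 'a idx set)"
    by (metis (no_types) Rep_idx Rep_idx_inject finite_imageD finite_lessThan finite_subset
        image_subsetI inj_onI)
  fix P :: "'a idx \<Rightarrow> bool" and a
  assume *: "\<And>x. (\<And>y. y < x \<Longrightarrow> P y) \<Longrightarrow> P x"
  show "P a"
    by (induction a rule: measure_induct_rule[of Rep_idx]) (use * in \<open>auto simp: less_idx_def\<close>)
qed (auto simp: less_eq_idx_def less_idx_def Rep_idx_inject)
end

lemma card_idx: "CARD('m::finite idx) = CARD('m)"
  using type_definition.card[OF type_definition_idx] by simp

lemma ex_bij_idx: "\<exists>\<pi> :: 'm::finite idx \<Rightarrow> 'm. bij \<pi>"
  using finite_same_card_bij[of "UNIV :: 'm idx set" "UNIV :: 'm set"] by (auto simp: card_idx)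

text \<open>A bijection of the index types conjugates the permutations in the Leibniz sum, and
  conjugation keeps the sign.\<close>

lemma det_reindex:
  fixes A :: "real^'m::finite^'m" and \<pi> :: "'k::finite \<Rightarrow> 'm"
  assumes "bij \<pi>"
  shows "det (\<chi> i j. A $ \<pi> i $ \<pi> j) = det A"
proof -
  have inj: "inj \<pi>" and surj: "surj \<pi>" using assms by (auto simp: bij_def)
  let ?m = "map_permutation UNIV \<pi>"
  have "det A = (\<Sum>p | p permutes (UNIV::'k set). of_int (sign (?m p)) * (\<Prod>i\<in>UNIV. A $ i $ ?m p i))"
    unfolding det_def
  proof (rule sum.reindex_bij_betw[symmetric])
    show "bij_betw ?m {p. p permutes UNIV} {p. p permutes UNIV}"
    proof (rule bij_betw_byWitness[where f'="map_permutation UNIV (inv \<pi>)"])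
      show "\<forall>p\<in>{p. p permutes UNIV}. map_permutation UNIV (inv \<pi>) (?m p) = p"
        using inj surj by (auto intro!: map_permutation_compose_inv[OF assms])
      show "\<forall>p\<in>{p. p permutes UNIV}. ?m (map_permutation UNIV (inv \<pi>) p) = p"
        using inj surj by (auto intro!: map_permutation_compose_inv[OF bij_imp_bij_inv[OF assms]] simp: surj_f_inv_f)
      show "?m ` {p. p permutes UNIV} \<subseteq> {p. p permutes UNIV}"
        by (auto intro!: map_permutation_permutes assms)
      show "map_permutation UNIV (inv \<pi>) ` {p. p permutes UNIV} \<subseteq> {p. p permutes UNIV}"
        by (auto intro!: map_permutation_permutes bij_imp_bij_inv assms)
    qed
  qed
  also have "\<dots> = (\<Sum>p | p permutes (UNIV::'k set). of_int (sign p) * (\<Prod>i\<in>UNIV. A $ \<pi> i $ \<pi> (p i)))"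
  proof (rule sum.cong[OF refl])
    fix p assume "p \<in> {p. p permutes (UNIV::'k set)}"
    then have p: "p permutes UNIV" by simp
    have "(\<Prod>i\<in>UNIV. A $ i $ ?m p i) = (\<Prod>i\<in>UNIV. A $ \<pi> i $ ?m p (\<pi> i))"
      by (rule prod.reindex_bij_betw[OF assms, symmetric])
    then show "of_int (sign (?m p)) * (\<Prod>i\<in>UNIV. A $ i $ ?m p i)
        = of_int (sign p) * (\<Prod>i\<in>UNIV. A $ \<pi> i $ \<pi> (p i))"
      using inj p by (simp add: sign_map_permutation map_permutation_apply)
  qed
  finally show ?thesis by (simp add: det_def)
qed

text \<open>Boxes pull back to boxes with the same side lengths up to order, and boxes determine
  Lebesgue measure.\<close>

lemma lborel_distr_reindex:
  fixes \<pi> :: "'k::finite \<Rightarrow> 'm::finite"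
  assumes "bij \<pi>"
  shows "distr lborel borel (\<lambda>x::real^'m. \<chi> i. x $ \<pi> i) = (lborel :: (real^'k) measure)"
proof (rule lborel_eqI[symmetric])
  fix l u :: "real^'k" assume lu: "\<And>b. b \<in> Basis \<Longrightarrow> l \<bullet> b \<le> u \<bullet> b"
  let ?p = "\<lambda>x::real^'k. \<chi> j::'m. x $ inv \<pi> j"
  have le: "l $ i \<le> u $ i" for i
    using lu[of "axis i 1"] by (auto simp: Basis_vec_def inner_axis)
  have [simp]: "inv \<pi> (\<pi> i) = i" "\<pi> (inv \<pi> j) = j" for i j
    using assms by (auto simp: bij_def surj_f_inv_f)
  have [measurable]: "(\<lambda>x::real^'m. \<chi> i. x $ \<pi> i) \<in> borel_measurable borel"
    by (intro borel_measurable_continuous_onI continuous_intros)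
  have "(\<lambda>x::real^'m. \<chi> i. x $ \<pi> i) -` box l u = box (?p l) (?p u)"
    by (auto simp: mem_box_cart) (metis \<open>\<And>i. inv \<pi> (\<pi> i) = i\<close> \<open>\<And>j. \<pi> (inv \<pi> j) = j\<close>)+
  then have "emeasure (distr lborel borel (\<lambda>x::real^'m. \<chi> i. x $ \<pi> i)) (box l u)
      = emeasure lborel (box (?p l) (?p u))"
    by (subst emeasure_distr) auto
  also have "\<dots> = ennreal (\<Prod>b\<in>Basis. (?p u - ?p l) \<bullet> b)"
    by (rule emeasure_lborel_box) (auto simp: Basis_vec_def inner_axis le)
  also have "(\<Prod>b\<in>Basis. (?p u - ?p l) \<bullet> b) = (\<Prod>j\<in>UNIV. ?p u $ j - ?p l $ j)"
    using prod.reindex[of "\<lambda>i. axis i (1::real)" UNIV "\<lambda>b. (?p u - ?p l) \<bullet> b"]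
    by (auto simp: Basis_vec_def inner_axis inj_on_def axis_eq_axis UNION_singleton_eq_range)
  also have "\<dots> = (\<Prod>i\<in>UNIV. u $ i - l $ i)"
    using prod.reindex_bij_betw[OF assms, of "\<lambda>j. ?p u $ j - ?p l $ j"] by simp
  also have "\<dots> = (\<Prod>b\<in>Basis. (u - l) \<bullet> b)"
    using prod.reindex[of "\<lambda>i. axis i (1::real)" UNIV "\<lambda>b. (u - l) \<bullet> b"]
    by (auto simp: Basis_vec_def inner_axis inj_on_def axis_eq_axis UNION_singleton_eq_range)
  finally show "emeasure (distr lborel borel (\<lambda>x::real^'m. \<chi> i. x $ \<pi> i)) (box l u)
      = (\<Prod>b\<in>Basis. (u - l) \<bullet> b)" .
qed simp

text \<open>The Jacobian identity is stated along \<open>T\<close>, so neither an explicit inverse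
  nor its derivative is ever needed. Integrability of \<open>q\<close> is a consequence of that of
  \<open>p\<close>.\<close>

lemma distr_density_change_of_variables_wellorder:
  fixes T :: "real^'m::{finite,wellorder} \<Rightarrow> real^'m::_" and p q :: "real^'m::_ \<Rightarrow> real"
  assumes der: "\<And>x. (T has_derivative T' x) (at x)"
    and inj: "inj T" and surj: "surj T"
    and p: "integrable lborel p" "\<And>x. 0 \<le> p x"
    and q: "q \<in> borel_measurable borel" "\<And>x. 0 \<le> q x"
    and eq: "\<And>x. \<bar>det (matrix (T' x))\<bar> * q (T x) = p x"
  shows "distr (density lborel p) lborel T = density lborel q"
proof (rule measure_eqI)
  fix A assume "A \<in> sets (distr (density lborel p) lborel T)"
  then have A[measurable]: "A \<in> sets borel" by simp
  have "continuous_on UNIV T"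
    using der by (meson continuous_at_imp_continuous_on has_derivative_continuous)
  then have T[measurable]: "T \<in> borel_measurable borel" by (rule borel_measurable_continuous_onI)
  note q(1)[measurable] borel_measurable_integrable[OF p(1), measurable]
  let ?P = "\<lambda>x. p x * indicator A (T x)" and ?Q = "\<lambda>x. q x * indicator A x"
  \<comment> \<open>The change of variables theorem is about functions into \<open>real^'n\<close>,
    so the integrand is wrapped as a vector with one entry; \<open>bl\<close> unwraps it.\<close>
  let ?F = "\<lambda>x. (vec (?Q x) :: real^1)"
  have P: "integrable lborel ?P"
    by (rule Bochner_Integration.integrable_bound[OF p(1)]) (auto simp: indicator_def p(2))
  then have "?P absolutely_integrable_on UNIV"
    by (simp add: set_integrable_def integrable_completion)
  then have "(vec \<circ> ?P :: _ \<Rightarrow> real^1) absolutely_integrable_on UNIV"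
    by (rule absolutely_integrable_linear) (auto simp: linear_linear linear_vec)
  moreover have Peq: "(\<lambda>x. \<bar>det (matrix (T' x))\<bar> *\<^sub>R ?F (T x)) = vec \<circ> ?P"
    by (auto simp: fun_eq_iff vec_eq_iff eq[symmetric])
  ultimately have *: "?F absolutely_integrable_on T ` UNIV \<and>
      integral (T ` UNIV) ?F = integral UNIV (vec \<circ> ?P :: _ \<Rightarrow> real^1)"
    using has_absolute_integral_change_of_variables[of UNIV T T' ?F "integral UNIV (vec \<circ> ?P :: _ \<Rightarrow> real^1)"] der inj
    by auto
  have bl: "bounded_linear (\<lambda>x::real^1. x $ 1)" by (rule bounded_linear_vec_nth)
  have "((\<lambda>x::real^1. x $ 1) \<circ> ?F) absolutely_integrable_on UNIV"
    using * surj bl by (intro absolutely_integrable_linear) auto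
  then have "integrable lebesgue ?Q" by (simp add: set_integrable_def o_def)
  then have Q: "integrable lborel ?Q" by (simp add: integrable_completion)
  have "integral UNIV ((\<lambda>x::real^1. x $ 1) \<circ> ?F) = integral UNIV ((\<lambda>x::real^1. x $ 1) \<circ> (vec \<circ> ?P :: _ \<Rightarrow> real^1))"
    using * surj \<open>(vec \<circ> ?P :: _ \<Rightarrow> real^1) absolutely_integrable_on UNIV\<close>
    by (simp add: integral_linear[OF _ bl] set_lebesgue_integral_eq_integral(1))
  then have "integral UNIV ?Q = integral UNIV ?P" by (simp add: o_def)
  then have int: "integral\<^sup>L lborel ?Q = integral\<^sup>L lborel ?P"
    using P Q by (simp add: integral_lborel)
  have "emeasure (distr (density lborel p) lborel T) A = emeasure (density lborel p) (T -` A)"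
    by (subst emeasure_distr) auto
  also have "\<dots> = (\<integral>\<^sup>+x. ennreal (?P x) \<partial>lborel)"
  proof -
    have "T -` A \<in> sets borel" using measurable_sets[OF T A] by simp
    then show ?thesis
    by (subst emeasure_density) (auto intro!: nn_integral_cong split: split_indicator)
  qed
  also have "\<dots> = ennreal (integral\<^sup>L lborel ?P)"
    using P p(2) by (intro nn_integral_eq_integral) auto
  also have "\<dots> = ennreal (integral\<^sup>L lborel ?Q)" by (simp add: int)
  also have "\<dots> = (\<integral>\<^sup>+x. ennreal (?Q x) \<partial>lborel)"
    using Q q(2) by (intro nn_integral_eq_integral[symmetric]) auto
  also have "\<dots> = emeasure (density lborel q) A"
    by (subst emeasure_density) (auto intro!: nn_integral_cong split: split_indicator)
  finally show "emeasure (distr (density lborel p) lborel T) A = emeasure (density lborel q) A" .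
qed simp

lemma distr_density_reindex:
  fixes \<pi> :: "'k::finite \<Rightarrow> 'm::finite" and p :: "real^'k \<Rightarrow> real"
  assumes "bij \<pi>" and [measurable]: "p \<in> borel_measurable borel"
  shows "distr (density lborel (\<lambda>x. ennreal (p (\<chi> i. x $ \<pi> i)))) lborel (\<lambda>x::real^'m. \<chi> i. x $ \<pi> i)
      = density lborel p"
proof -
  have [measurable]: "(\<lambda>x::real^'m. \<chi> i. x $ \<pi> i) \<in> borel_measurable borel"
    by (intro borel_measurable_continuous_onI continuous_intros)
  have "density (distr lborel lborel (\<lambda>x::real^'m. \<chi> i. x $ \<pi> i)) p
    = distr (density lborel (\<lambda>x. ennreal (p (\<chi> i. x $ \<pi> i)))) lborel (\<lambda>x::real^'m. \<chi> i. x $ \<pi> i)"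
    by (rule density_distr) auto
  moreover have "distr lborel lborel (\<lambda>x::real^'m. \<chi> i. x $ \<pi> i) = (lborel :: (real^'k) measure)"
    using lborel_distr_reindex[OF assms(1)] by (subst distr_cong[of _ lborel _ borel]) auto
  ultimately show ?thesis by simp
qed

text \<open>Conjugating \<open>T\<close> by a relabelling of the coordinates carries the problem to
  a well-ordered index type: the relabelling preserves Lebesgue measure, and the derivative keeps
  its determinant.\<close>

theorem distr_density_change_of_variables:
  fixes T :: "real^'m::finite \<Rightarrow> real^'m" and p q :: "real^'m \<Rightarrow> real"
  assumes der: "\<And>x. (T has_derivative T' x) (at x)"
    and inj: "inj T" and surj: "surj T"
    and p: "integrable lborel p" "\<And>x. 0 \<le> p x"
    and q: "q \<in> borel_measurable borel" "\<And>x. 0 \<le> q x"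
    and eq: "\<And>x. \<bar>det (matrix (T' x))\<bar> * q (T x) = p x"
  shows "distr (density lborel p) lborel T = density lborel q"
proof -
  obtain \<pi> :: "'m idx \<Rightarrow> 'm" where \<pi>: "bij \<pi>" using ex_bij_idx by blast
  have [simp]: "inv \<pi> (\<pi> i) = i" "\<pi> (inv \<pi> j) = j" for i j
    using \<pi> by (auto simp: bij_def surj_f_inv_f)
  define P where "P = (\<lambda>x::real^'m. \<chi> i. x $ \<pi> i)"
  define R where "R = (\<lambda>x::real^'m idx. \<chi> i. x $ inv \<pi> i)"
  have [simp]: "R (P x) = x" "P (R y) = y" for x y by (simp_all add: P_def R_def vec_eq_iff)
  have P: "bounded_linear P" and R: "bounded_linear R"
    by (auto simp: linear_conv_bounded_linear[symmetric] linear_iff vec_eq_iff P_def R_def)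
  note [measurable] = borel_measurable_continuous_onI[OF linear_continuous_on[OF P]]
    borel_measurable_continuous_onI[OF linear_continuous_on[OF R]] q(1)
    borel_measurable_integrable[OF p(1), simplified]
  have "continuous_on UNIV T"
    using der by (meson continuous_at_imp_continuous_on has_derivative_continuous)
  then have T[measurable]: "T \<in> borel_measurable borel" by (rule borel_measurable_continuous_onI)
  have dR: "distr lborel borel R = lborel" and dP: "distr lborel borel P = lborel"
    unfolding P_def R_def using \<pi> by (auto intro!: lborel_distr_reindex bij_imp_bij_inv)
  define S where "S = P \<circ> T \<circ> R"
  have main: "distr (density lborel (\<lambda>x. ennreal (p (R x)))) lborel S = density lborel (\<lambda>x. ennreal (q (R x)))"
  proof (rule distr_density_change_of_variables_wellorder[where T'="\<lambda>x. P \<circ> T' (R x) \<circ> R"])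
    show "(S has_derivative P \<circ> T' (R x) \<circ> R) (at x)" for x
      unfolding S_def
      by (intro diff_chain_at bounded_linear_imp_has_derivative P R) (use der in auto)
    show "inj S" "surj S"
    proof -
      show "inj S" using inj unfolding S_def inj_def by (metis \<open>\<And>y. P (R y) = y\<close> \<open>\<And>x. R (P x) = x\<close> comp_apply)
      show "surj S" using surj unfolding S_def surj_def by (metis \<open>\<And>y. P (R y) = y\<close> \<open>\<And>x. R (P x) = x\<close> comp_apply)
    qed
    have "integrable (distr lborel borel P) (\<lambda>x. p (R x))"
      by (subst integrable_distr_eq) (use p in auto)
    then show "integrable lborel (\<lambda>x. p (R x))" by (simp add: dP)
    show "\<bar>det (matrix (P \<circ> T' (R x) \<circ> R))\<bar> * q (R (S x)) = p (R x)" for x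
    proof -
      have [simp]: "R (axis j 1) = axis (\<pi> j) 1" for j
        by (auto simp: R_def axis_def vec_eq_iff)
      have "matrix (P \<circ> T' (R x) \<circ> R) = (\<chi> i j. matrix (T' (R x)) $ \<pi> i $ \<pi> j)"
        by (simp add: matrix_def vec_eq_iff P_def)
      then show ?thesis
        using det_reindex[OF \<pi>, of "matrix (T' (R x))"] eq[of "R x"] by (simp add: S_def)
    qed
  qed (use p q in auto)
  have pushR: "distr (density lborel (\<lambda>x. ennreal (f (R x)))) lborel R = density lborel f"
    if "f \<in> borel_measurable borel" for f :: "real^'m \<Rightarrow> real"
    using distr_density_reindex[OF bij_imp_bij_inv[OF \<pi>] that] unfolding R_def .
  \<comment> \<open>The relabelling is undone: \<open>R\<close> pushes the density
    \<open>q o R\<close> back to \<open>q\<close>, and \<open>R o S = T o R\<close> moves it past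
    the map.\<close>
  have "density lborel q = distr (distr (density lborel (\<lambda>x. ennreal (p (R x)))) lborel S) lborel R"
    using pushR[OF q(1)] by (simp add: main)
  also have "\<dots> = distr (density lborel (\<lambda>x. ennreal (p (R x)))) lborel (R \<circ> S)"
    by (rule distr_distr) (auto simp: S_def)
  also have "R \<circ> S = T \<circ> R" by (auto simp: S_def)
  also have "distr (density lborel (\<lambda>x. ennreal (p (R x)))) lborel (T \<circ> R)
      = distr (distr (density lborel (\<lambda>x. ennreal (p (R x)))) lborel R) lborel T"
    by (rule distr_distr[symmetric]) auto
  also have "\<dots> = distr (density lborel p) lborel T"
    by (simp add: pushR)
  finally show ?thesis ..
qed

subsection \<open>Isotropic Gaussian measures\<close>

text \<open>\<open>model_distr X \<beta> \<sigma>\<close> is the case of mean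
  \<open>X *v \<beta>\<close>. A free mean and dimension let the same notion describe the whitened
  vector.\<close>

definition gauss :: "real^'n::finite \<Rightarrow> real \<Rightarrow> (real^'n) measure" where
  "gauss \<mu> \<sigma> = density lborel (\<lambda>y. ennreal ((2 * pi * \<sigma>\<^sup>2) powr (- real CARD('n) / 2)
      * exp (- (norm (y - \<mu>))\<^sup>2 / (2 * \<sigma>\<^sup>2))))"

lemma gauss_density_eq_prod:
  fixes y \<mu> :: "real^'n::finite"
  assumes "0 < \<sigma>"
  shows "(2 * pi * \<sigma>\<^sup>2) powr (- real CARD('n) / 2) * exp (- (norm (y - \<mu>))\<^sup>2 / (2 * \<sigma>\<^sup>2))
    = (\<Prod>i\<in>UNIV. normal_density (\<mu> $ i) \<sigma> (y $ i))"
proof -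
  have "(1 / sqrt (2 * pi * \<sigma>\<^sup>2)) ^ CARD('n) = ((2 * pi * \<sigma>\<^sup>2) powr (- (1/2))) powr real CARD('n)"
    using assms by (simp add: powr_realpow powr_minus powr_half_sqrt divide_simps)
  also have "\<dots> = (2 * pi * \<sigma>\<^sup>2) powr (- real CARD('n) / 2)"
    by (simp add: powr_powr)
  finally have "(1 / sqrt (2 * pi * \<sigma>\<^sup>2)) ^ CARD('n) = (2 * pi * \<sigma>\<^sup>2) powr (- real CARD('n) / 2)" .
  moreover have "exp (- (norm (y - \<mu>))\<^sup>2 / (2 * \<sigma>\<^sup>2)) = (\<Prod>i\<in>UNIV. exp (- (y $ i - \<mu> $ i)\<^sup>2 / (2 * \<sigma>\<^sup>2)))"
  proof -
    have "(norm (y - \<mu>))\<^sup>2 = (\<Sum>i\<in>UNIV. (y $ i - \<mu> $ i)\<^sup>2)"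
      unfolding power2_norm_eq_inner by (simp add: inner_vec_def power2_eq_square)
    then show ?thesis
      by (simp add: exp_sum[symmetric] sum_negf sum_divide_distrib[symmetric])
  qed
  ultimately show ?thesis
    unfolding normal_density_def prod.distrib by simp
qed

lemma borel_measurable_vec_lambda:
  assumes "\<And>i. (\<lambda>x. f x i) \<in> borel_measurable M"
  shows "(\<lambda>x. (\<chi> i. f x i) :: real^'n::finite) \<in> borel_measurable M"
  using assms by (subst borel_measurable_euclidean_space) (auto simp: Basis_vec_def inner_axis)

lemma lborel_eq_distr_PiM:
  "(lborel :: (real^'n::finite) measure) = distr (\<Pi>\<^sub>M i\<in>UNIV. (lborel :: real measure)) borel (\<lambda>f. \<chi> i. f i)"
proof (rule lborel_eqI)
  interpret product_sigma_finite "\<lambda>_::'n. lborel :: real measure" ..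
  fix l u :: "real^'n" assume lu: "\<And>b. b \<in> Basis \<Longrightarrow> l \<bullet> b \<le> u \<bullet> b"
  have le: "l $ i \<le> u $ i" for i
    using lu[of "axis i 1"] by (auto simp: Basis_vec_def inner_axis)
  have m: "(\<lambda>f. \<chi> i. f i) \<in> measurable (\<Pi>\<^sub>M i\<in>(UNIV::'n set). (lborel :: real measure)) borel"
    by (rule borel_measurable_vec_lambda) measurable
  have "emeasure (distr (\<Pi>\<^sub>M i\<in>(UNIV::'n set). (lborel :: real measure)) borel (\<lambda>f. \<chi> i. f i)) (box l u)
      = emeasure (\<Pi>\<^sub>M i\<in>(UNIV::'n set). (lborel :: real measure)) (\<Pi>\<^sub>E i\<in>UNIV. {l $ i<..<u $ i})"
    by (subst emeasure_distr[OF m])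
      (auto intro!: arg_cong[where f="emeasure _"] simp: space_PiM mem_box_cart PiE_iff)
  also have "\<dots> = (\<Prod>i\<in>UNIV. ennreal (u $ i - l $ i))"
    by (subst emeasure_PiM) (auto simp: le)
  also have "\<dots> = ennreal (\<Prod>i\<in>UNIV. u $ i - l $ i)"
    by (rule prod_ennreal) (simp add: le)
  also have "(\<Prod>i\<in>UNIV. u $ i - l $ i) = (\<Prod>b\<in>Basis. (u - l) \<bullet> b)"
    using prod.reindex[of "\<lambda>i. axis i (1::real)" UNIV "\<lambda>b. (u - l) \<bullet> b"]
    by (auto simp: Basis_vec_def inner_axis inj_on_def axis_eq_axis UNION_singleton_eq_range)
  finally show "emeasure (distr (\<Pi>\<^sub>M i\<in>(UNIV::'n set). (lborel :: real measure)) borel (\<lambda>f. \<chi> i. f i)) (box l u)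
      = (\<Prod>b\<in>Basis. (u - l) \<bullet> b)" .
qed simp

text \<open>With independent coordinates, total mass one and the marginal laws become general facts
  about product measures.\<close>

lemma gauss_eq_distr_PiM:
  fixes \<mu> :: "real^'n::finite"
  assumes \<sigma>: "0 < \<sigma>"
  shows "gauss \<mu> \<sigma> = distr (\<Pi>\<^sub>M i\<in>UNIV. density lborel (normal_density (\<mu> $ i) \<sigma>)) borel (\<lambda>f. \<chi> i. f i)"
proof -
  interpret L: product_sigma_finite "\<lambda>_::'n. lborel :: real measure" ..
  interpret N: product_prob_space "\<lambda>i::'n. density lborel (normal_density (\<mu> $ i) \<sigma>)" UNIV
    using \<sigma> by (intro product_prob_spaceI prob_space_normal_density)
  let ?L = "\<Pi>\<^sub>M i\<in>(UNIV::'n set). (lborel :: real measure)"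
  let ?d = "\<lambda>y::real^'n. \<Prod>i\<in>UNIV. normal_density (\<mu> $ i) \<sigma> (y $ i)"
  have m[measurable]: "(\<lambda>f. \<chi> i. f i) \<in> measurable ?L borel"
    by (rule borel_measurable_vec_lambda) measurable
  have d[measurable]: "?d \<in> borel_measurable borel"
    by measurable
  have "gauss \<mu> \<sigma> = density (distr ?L borel (\<lambda>f. \<chi> i. f i)) (\<lambda>y. ennreal (?d y))"
    unfolding gauss_def gauss_density_eq_prod[OF \<sigma>] by (simp add: lborel_eq_distr_PiM[symmetric])
  also have "\<dots> = distr (density ?L (\<lambda>f. ennreal (?d (\<chi> i. f i)))) borel (\<lambda>f. \<chi> i. f i)"
    by (rule density_distr) auto
  also have "density ?L (\<lambda>f. ennreal (?d (\<chi> i. f i)))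
      = (\<Pi>\<^sub>M i\<in>UNIV. density lborel (normal_density (\<mu> $ i) \<sigma>))"
  proof (rule N.PiM_eqI)
    show "sets (density ?L (\<lambda>f. ennreal (?d (\<chi> i. f i))))
      = sets (\<Pi>\<^sub>M i\<in>UNIV. density lborel (normal_density (\<mu> $ i) \<sigma>))"
      by (auto intro!: sets_PiM_cong)
    fix A assume A: "\<And>i. i \<in> UNIV \<Longrightarrow> A i \<in> sets (density lborel (normal_density (\<mu> $ i) \<sigma>))"
    then have [measurable]: "A i \<in> sets borel" for i by simp
    \<comment> \<open>Membership in a rectangle factors over the coordinates, which brings the
      integral into product form for Fubini.\<close>
    have ind: "indicator (Pi\<^sub>E UNIV A) f = (\<Prod>i\<in>UNIV. indicator (A i) (f i) :: ennreal)" for f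
    proof (cases "\<forall>i. f i \<in> A i")
      case False
      then obtain i where "f i \<notin> A i" by blast
      then have "(\<Prod>i\<in>UNIV. indicator (A i) (f i) :: ennreal) = 0" by (intro prod_zero bexI[of _ i]) auto
      then show ?thesis using False by (auto simp: PiE_iff)
    qed (auto simp: PiE_iff)
    have "Pi\<^sub>E UNIV A \<in> sets ?L" by (intro sets_PiM_I_finite) auto
    then have "emeasure (density ?L (\<lambda>f. ennreal (?d (\<chi> i. f i)))) (Pi\<^sub>E UNIV A)
      = (\<integral>\<^sup>+f. (\<Prod>i\<in>UNIV. ennreal (normal_density (\<mu> $ i) \<sigma> (f i)) * indicator (A i) (f i)) \<partial>?L)"
      by (subst emeasure_density)
        (auto intro!: nn_integral_cong simp: prod_ennreal prod.distrib ind)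
    also have "\<dots> = (\<Prod>i\<in>UNIV. \<integral>\<^sup>+x. ennreal (normal_density (\<mu> $ i) \<sigma> x) * indicator (A i) x \<partial>lborel)"
      by (rule L.product_nn_integral_prod) auto
    also have "\<dots> = (\<Prod>i\<in>UNIV. emeasure (density lborel (normal_density (\<mu> $ i) \<sigma>)) (A i))"
      by (simp add: emeasure_density)
    finally show "emeasure (density ?L (\<lambda>f. ennreal (?d (\<chi> i. f i)))) (Pi\<^sub>E UNIV A)
      = (\<Prod>i\<in>UNIV. emeasure (density lborel (normal_density (\<mu> $ i) \<sigma>)) (A i))" .
  qed simp
  finally show ?thesis .
qed

lemma prob_space_gauss: "0 < \<sigma> \<Longrightarrow> prob_space (gauss \<mu> \<sigma>)"
  unfolding gauss_eq_distr_PiM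
  by (intro prob_space.prob_space_distr prob_space_PiM prob_space_normal_density)
    (auto intro!: borel_measurable_vec_lambda)

lemma sets_gauss[measurable_cong, simp]: "sets (gauss \<mu> \<sigma>) = sets borel"
  by (simp add: gauss_def)

text \<open>Injectivity of \<open>\<iota>\<close> is what keeps the selected factors independent: no
  coordinate is picked twice.\<close>

lemma distr_gauss_coordinates:
  fixes \<mu> :: "real^'n::finite" and \<iota> :: "'k::finite \<Rightarrow> 'n"
  assumes \<sigma>: "0 < \<sigma>" and \<iota>: "inj \<iota>"
  shows "distr (gauss \<mu> \<sigma>) borel (\<lambda>y. \<chi> j. y $ \<iota> j) = gauss (\<chi> j. \<mu> $ \<iota> j) \<sigma>"
proof -
  let ?N = "\<lambda>i. density lborel (normal_density (\<mu> $ i) \<sigma>)"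
  have [measurable]: "(\<lambda>f. \<chi> i. f i) \<in> measurable (\<Pi>\<^sub>M i\<in>UNIV. ?N i) borel"
    "(\<lambda>f. \<chi> i. f i) \<in> measurable (\<Pi>\<^sub>M j\<in>UNIV. ?N (\<iota> j)) borel"
    by (auto intro!: borel_measurable_vec_lambda)
  have "distr (gauss \<mu> \<sigma>) borel (\<lambda>y. \<chi> j. y $ \<iota> j)
      = distr (\<Pi>\<^sub>M i\<in>UNIV. ?N i) borel ((\<lambda>y. \<chi> j. y $ \<iota> j) \<circ> (\<lambda>f. \<chi> i. f i))"
    unfolding gauss_eq_distr_PiM[OF \<sigma>]
    by (intro distr_distr) (auto intro!: borel_measurable_continuous_onI continuous_intros)
  also have "\<dots> = distr (\<Pi>\<^sub>M i\<in>UNIV. ?N i) borel ((\<lambda>f. \<chi> j. f j) \<circ> (\<lambda>\<omega>. \<lambda>j\<in>UNIV. \<omega> (\<iota> j)))"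
    by (simp add: o_def restrict_UNIV)
  also have "\<dots> = distr (distr (\<Pi>\<^sub>M i\<in>UNIV. ?N i) (\<Pi>\<^sub>M j\<in>UNIV. ?N (\<iota> j)) (\<lambda>\<omega>. \<lambda>j\<in>UNIV. \<omega> (\<iota> j))) borel (\<lambda>f. \<chi> j. f j)"
    by (rule distr_distr[symmetric]) (auto intro!: measurable_restrict)
  also have "distr (\<Pi>\<^sub>M i\<in>UNIV. ?N i) (\<Pi>\<^sub>M j\<in>UNIV. ?N (\<iota> j)) (\<lambda>\<omega>. \<lambda>j\<in>UNIV. \<omega> (\<iota> j)) = (\<Pi>\<^sub>M j\<in>UNIV. ?N (\<iota> j))"
    using \<sigma> \<iota> by (intro distr_PiM_reindex prob_space_normal_density) auto
  finally show ?thesis by (simp add: gauss_eq_distr_PiM[OF \<sigma>])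
qed

text \<open>The total mass is known from the product representation, so the integral itself is not
  computed.\<close>

lemma gauss_density_integrable:
  assumes "0 < \<sigma>"
  shows "integrable lborel (\<lambda>y::real^'n::finite. (2 * pi * \<sigma>\<^sup>2) powr (- real CARD('n) / 2)
      * exp (- (norm (y - \<mu>))\<^sup>2 / (2 * \<sigma>\<^sup>2)))"
proof (rule integrableI_nonneg)
  interpret prob_space "gauss \<mu> \<sigma>" by (rule prob_space_gauss[OF assms])
  show "(\<integral>\<^sup>+y. ennreal ((2 * pi * \<sigma>\<^sup>2) powr (- real CARD('n) / 2)
      * exp (- (norm (y - \<mu>))\<^sup>2 / (2 * \<sigma>\<^sup>2))) \<partial>lborel) < \<infinity>"
    using emeasure_space_1 by (simp add: gauss_def emeasure_density)
qed auto

text \<open>A rotation preserves distances and has determinant of modulus one, so it moves only the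
  mean.\<close>

lemma distr_gauss_orthogonal:
  fixes Q :: "real^'n::finite^'n"
  assumes \<sigma>: "0 < \<sigma>" and Q: "orthogonal_matrix Q"
  shows "distr (gauss \<mu> \<sigma>) borel ((*v) Q) = gauss (Q *v \<mu>) \<sigma>"
proof -
  have QQ: "transpose Q ** Q = mat 1" "Q ** transpose Q = mat 1"
    using Q by (auto simp: orthogonal_matrix_def)
  have "distr (gauss \<mu> \<sigma>) lborel ((*v) Q) = gauss (Q *v \<mu>) \<sigma>"
    unfolding gauss_def
  proof (rule distr_density_change_of_variables[where T'="\<lambda>_. (*v) Q"])
    show "inj ((*v) Q)" by (metis QQ(1) matrix_left_invertible_injective)
    show "surj ((*v) Q)" by (metis QQ(2) matrix_right_invertible_surjective)
    have "norm (Q *v v) = norm v" for v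
      using Q orthogonal_transformation_matrix[of "(*v) Q"] by (auto simp: orthogonal_transformation)
    then have "norm (Q *v x - Q *v \<mu>) = norm (x - \<mu>)" for x
      by (simp add: matrix_vector_mult_diff_distrib[symmetric])
    moreover have "\<bar>det Q\<bar> = 1" using det_orthogonal_matrix[OF Q] by auto
    ultimately show "\<bar>det (matrix ((*v) Q))\<bar> * ((2 * pi * \<sigma>\<^sup>2) powr (- real CARD('n) / 2) * exp (- (norm (Q *v x - Q *v \<mu>))\<^sup>2 / (2 * \<sigma>\<^sup>2)))
      = (2 * pi * \<sigma>\<^sup>2) powr (- real CARD('n) / 2) * exp (- (norm (x - \<mu>))\<^sup>2 / (2 * \<sigma>\<^sup>2))" for x
      by simp
    show "integrable lborel (\<lambda>y. (2 * pi * \<sigma>\<^sup>2) powr (- real CARD('n) / 2) * exp (- (norm (y - \<mu>))\<^sup>2 / (2 * \<sigma>\<^sup>2)))"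
      by (rule gauss_density_integrable[OF \<sigma>])
  qed (auto intro!: bounded_linear_imp_has_derivative)
  then show ?thesis
    by (subst distr_cong[of _ "gauss \<mu> \<sigma>" _ lborel]) auto
qed

text \<open>The rows of \<open>L\<close> are orthonormal and extend to an orthonormal basis;
  \<open>\<iota>\<close> records where they land among the rows of \<open>Q\<close>.\<close>

lemma orthogonal_matrix_extending_rows:
  fixes L :: "real^'n::finite^'k::finite"
  assumes L: "L ** transpose L = mat 1"
  obtains Q :: "real^'n^'n" and \<iota> :: "'k \<Rightarrow> 'n"
  where "orthogonal_matrix Q" "inj \<iota>" "\<And>j. Q $ \<iota> j = L $ j"
proof -
  have LL: "L $ i \<bullet> L $ j = (if i = j then 1 else 0)" for i j
    using L by (simp add: vec_eq_iff matrix_matrix_mult_def transpose_def mat_def inner_vec_def)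
  define S where "S = range (($) L)"
  have S: "pairwise orthogonal S" "\<And>x. x \<in> S \<Longrightarrow> norm x = 1" 
    using LL by (auto simp: S_def pairwise_def orthogonal_def norm_eq_1)
  have injL: "inj (($) L)"
    using LL by (metis injI zero_neq_one)
  obtain U where U: "U \<inter> insert 0 S = {}" "pairwise orthogonal (S \<union> U)" "span (S \<union> U) = span (S \<union> UNIV)"
    using orthogonal_extension_strong[OF S(1)] by blast
  define V where "V = (\<lambda>x. x /\<^sub>R norm x) ` (S \<union> U)"
  have 0: "0 \<notin> S \<union> U" using S(2) U(1) by force
  have SV: "S \<subseteq> V"
    using S(2) by (force simp: V_def)
  have nV: "norm x = 1" if V: "x \<in> V" for x
  proof -
    obtain y where "y \<in> S \<union> U" and x: "x = y /\<^sub>R norm y" using V by (auto simp: V_def)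
    then have "y \<noteq> 0" using 0 by metis
    then show ?thesis by (simp add: x)
  qed
  have oV: "pairwise orthogonal V"
    unfolding V_def pairwise_image using U(2) by (auto simp: pairwise_def orthogonal_def)
  have indV: "independent V"
    using oV nV by (metis norm_zero pairwise_orthogonal_independent zero_neq_one)
  \<comment> \<open>Normalising keeps distinct vectors distinct: otherwise a unit vector would be
    orthogonal to itself. Hence the count \<open>CARD('n)\<close> survives.\<close>
  have "inj_on (\<lambda>x. x /\<^sub>R norm x) (S \<union> U)"
  proof (rule inj_onI, rule ccontr)
    fix x y assume xy: "x \<in> S \<union> U" "y \<in> S \<union> U" "x /\<^sub>R norm x = y /\<^sub>R norm y" "x \<noteq> y"
    then have "orthogonal x y" using U(2) by (auto simp: pairwise_def)
    then have "(x /\<^sub>R norm x) \<bullet> (y /\<^sub>R norm y) = 0" by (simp add: orthogonal_def)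
    moreover have "x /\<^sub>R norm x \<in> V" using xy(1) unfolding V_def by (rule imageI)
    then have "(x /\<^sub>R norm x) \<bullet> (x /\<^sub>R norm x) = 1" using nV norm_eq_1 by blast
    ultimately show False using xy(3) by (metis zero_neq_one)
  qed
  then have "card V = card (S \<union> U)" by (simp add: V_def card_image)
  moreover have "independent (S \<union> U)"
    using U(2) 0 pairwise_orthogonal_independent by blast
  then have "card (S \<union> U) = CARD('n)"
    using U(3) by (metis DIM_cart DIM_real dim_UNIV dim_span indep_card_eq_dim_span nat_mult_1_right span_UNIV sup_top_right)
  ultimately have cV: "card V = CARD('n)" by simp
  \<comment> \<open>Any enumeration of the basis may serve as the rows of \<open>Q\<close>, since
    \<open>\<iota>\<close> is read off from it afterwards.\<close>
  then obtain \<phi> where \<phi>: "bij_betw \<phi> (UNIV::'n set) V"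
    by (metis finite_class.finite_UNIV finite_same_card_bij finiteI_independent indV)
  define \<iota> where "\<iota> j = inv_into UNIV \<phi> (L $ j)" for j
  have \<phi>\<iota>: "\<phi> (\<iota> j) = L $ j" for j
    unfolding \<iota>_def by (rule f_inv_into_f) (use \<phi> SV in \<open>auto simp: S_def bij_betw_def\<close>)
  show thesis
  proof
    have row: "row i (\<chi> i. \<phi> i) = \<phi> i" for i by (simp add: row_def vec_eq_iff)
    show "orthogonal_matrix (\<chi> i. \<phi> i)"
      unfolding orthogonal_matrix_orthonormal_rows row
      using nV oV \<phi> unfolding bij_betw_def pairwise_def inj_on_def by (metis UNIV_I rangeI)
    show "inj \<iota>" using injL \<phi>\<iota> by (metis injD injI)
    show "(\<chi> i. \<phi> i) $ \<iota> j = L $ j" for j by (simp add: \<phi>\<iota>)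
  qed
qed

text \<open>\<open>L\<close> is \<open>Q\<close> followed by the selection of the coordinates
  \<open>\<iota>\<close>, so a rotation and a marginalisation suffice. This is where the dimension
  falls from \<open>n\<close> to \<open>k\<close>.\<close>

theorem distr_gauss_linear:
  fixes L :: "real^'n::finite^'k::finite"
  assumes \<sigma>: "0 < \<sigma>" and L: "L ** transpose L = mat 1"
  shows "distr (gauss \<mu> \<sigma>) borel ((*v) L) = gauss (L *v \<mu>) \<sigma>"
proof -
  obtain Q :: "real^'n^'n" and \<iota> :: "'k \<Rightarrow> 'n"
    where Q: "orthogonal_matrix Q" and \<iota>: "inj \<iota>" and QL: "\<And>j. Q $ \<iota> j = L $ j"
    using orthogonal_matrix_extending_rows[OF L] by blast
  have eq: "(\<chi> j. (Q *v y) $ \<iota> j) = L *v y" for y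
    by (simp add: vec_eq_iff matrix_vector_mult_def QL)
  have "distr (gauss \<mu> \<sigma>) borel ((*v) L) = distr (gauss \<mu> \<sigma>) borel ((\<lambda>y. \<chi> j. y $ \<iota> j) \<circ> (*v) Q)"
    by (simp add: o_def eq)
  also have "\<dots> = distr (distr (gauss \<mu> \<sigma>) borel ((*v) Q)) borel (\<lambda>y. \<chi> j. y $ \<iota> j)"
    by (rule distr_distr[symmetric])
      (auto simp: measurable_cong_sets[OF sets_gauss refl] intro!: borel_measurable_continuous_onI continuous_intros)
  also have "\<dots> = gauss (L *v \<mu>) \<sigma>"
    by (simp add: distr_gauss_orthogonal distr_gauss_coordinates \<sigma> Q \<iota> eq)
  finally show ?thesis .
qed

subsection \<open>Square roots of positive definite matrices\<close>

text \<open>An eigenvector is found as a maximiser of the quadratic form on the unit sphere of the subspace.\<close>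

lemma selfadjoint_eigenvector_exists:
  fixes f :: "'a::euclidean_space \<Rightarrow> 'a"
  assumes lin: "linear f" and sa: "\<And>x y. f x \<bullet> y = x \<bullet> f y"
    and S: "subspace S" "S \<noteq> {0}" and fS: "f ` S \<subseteq> S"
  obtains v c where "v \<in> S" "norm v = 1" "f v = c *\<^sub>R v"
proof -
  have contf: "continuous_on UNIV f" using lin linear_continuous_on linear_linear by blast
  define K where "K = S \<inter> sphere 0 1"
  have "compact K"
    unfolding K_def by (intro closed_Int_compact closed_subspace S compact_sphere)
  obtain s where "s \<in> S" "s \<noteq> 0"
    using S subspace_0 by blast
  then have "s /\<^sub>R norm s \<in> K" using S by (auto simp: K_def subspace_scale)
  then have "K \<noteq> {}" by blast
  moreover have "continuous_on K (\<lambda>x. x \<bullet> f x)"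
    by (intro continuous_intros continuous_on_subset[OF contf]) auto
  ultimately obtain v where v: "v \<in> K" and max: "\<And>x. x \<in> K \<Longrightarrow> x \<bullet> f x \<le> v \<bullet> f v"
    using continuous_attains_sup[OF \<open>compact K\<close>] by blast
  have vS: "v \<in> S" and nv: "norm v = 1" using v by (auto simp: K_def)
  define c where "c = v \<bullet> f v"
  have le: "x \<bullet> f x \<le> c * (x \<bullet> x)" if x: "x \<in> S" for x
  proof (cases "x = 0")
    case False
    then have "x /\<^sub>R norm x \<in> K" using x S by (auto simp: K_def subspace_scale)
    then have "(x /\<^sub>R norm x) \<bullet> f (x /\<^sub>R norm x) \<le> c" using max c_def by blast
    then show ?thesis using False
      by (simp add: linear_cmul[OF lin] divide_simps power2_eq_square[symmetric] power2_norm_eq_inner[symmetric] split: if_splits)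
  qed (simp add: linear_0[OF lin])
  \<comment> \<open>\<open>w\<close> is the defect in the eigenvector equation and is orthogonal to
    \<open>v\<close>; the aim is \<open>w = 0\<close>.\<close>
  define w where "w = f v - c *\<^sub>R v"
  have wS: "w \<in> S" using vS fS S by (auto simp: w_def intro!: subspace_diff subspace_scale)
  have vw: "v \<bullet> w = 0" using nv by (simp add: w_def c_def inner_diff_right norm_eq_1)
  have fvw: "f v \<bullet> w = w \<bullet> w"
    using vw by (simp add: w_def inner_diff_left inner_diff_right inner_commute)
  \<comment> \<open>Comparison of the form at \<open>v + t w\<close> with its maximum: the first
    order gain \<open>2 t |w|^2\<close> has to be absorbed by a term of order
    \<open>t^2\<close>.\<close>
  have quad: "2 * t * (w \<bullet> w) \<le> t\<^sup>2 * (c * (w \<bullet> w) - w \<bullet> f w)" for t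
  proof -
    have "v + t *\<^sub>R w \<in> S" using vS wS S by (simp add: subspace_add subspace_scale)
    from le[OF this] have "v \<bullet> f v + 2 * t * (f v \<bullet> w) + t\<^sup>2 * (w \<bullet> f w) \<le> c * (1 + t\<^sup>2 * (w \<bullet> w))"
      using vw nv sa[of w v]
      by (simp add: linear_add[OF lin] linear_cmul[OF lin] inner_add_left inner_add_right norm_eq_1
          inner_commute power2_eq_square algebra_simps)
    then show ?thesis by (simp add: c_def[symmetric] fvw algebra_simps)
  qed
  have "w \<bullet> w = 0"
  proof (rule ccontr)
    assume "w \<bullet> w \<noteq> 0"
    then have pos: "w \<bullet> w > 0" by simp
    \<comment> \<open>\<open>m\<close> is a positive bound for the quadratic coefficient;
      \<open>t = |w|^2 / m\<close> makes the linear term twice the bound on the quadratic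
      one.\<close>
    define m where "m = \<bar>c * (w \<bullet> w) - w \<bullet> f w\<bar> + 1"
    have m: "m > 0" "c * (w \<bullet> w) - w \<bullet> f w \<le> m" by (auto simp: m_def)
    have "2 * ((w \<bullet> w) / m) * (w \<bullet> w) \<le> ((w \<bullet> w) / m)\<^sup>2 * m"
      using quad[of "(w \<bullet> w) / m"] mult_left_mono[OF m(2), of "((w \<bullet> w) / m)\<^sup>2"] by simp
    then show False using m(1) mult_pos_pos[OF pos pos] by (simp add: power2_eq_square field_simps)
  qed
  then have "f v = c *\<^sub>R v" by (simp add: w_def)
  then show thesis using that vS nv by blast
qed

text \<open>Splitting off an eigenvector leaves its orthogonal complement in \<open>S\<close>, again
  invariant because \<open>f\<close> is self-adjoint. Hence the induction runs over all invariant
  subspaces.\<close>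

lemma selfadjoint_orthonormal_eigenbasis_subspace:
  fixes f :: "'a::euclidean_space \<Rightarrow> 'a"
  assumes lin: "linear f" and sa: "\<And>x y. f x \<bullet> y = x \<bullet> f y"
  shows "subspace S \<Longrightarrow> f ` S \<subseteq> S \<Longrightarrow> \<exists>B c. finite B \<and> pairwise orthogonal B \<and> (\<forall>v\<in>B. norm v = 1 \<and> f v = c v *\<^sub>R v) \<and> span B = S"
proof (induction "dim S" arbitrary: S rule: less_induct)
  case less
  show ?case
  proof (cases "S = {0}")
    case True
    then show ?thesis by (intro exI[of _ "{}"]) auto
  next
    case False
    obtain v c0 where v: "v \<in> S" "norm v = 1" "f v = c0 *\<^sub>R v"
      using selfadjoint_eigenvector_exists[OF lin sa less(2) False less(3)] by blast
    define S' where "S' = {x \<in> S. v \<bullet> x = 0}"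
    have S': "subspace S'"
      unfolding S'_def subspace_def using less(2)
      by (auto simp: subspace_0 subspace_add subspace_scale inner_add_right)
    have fS': "f ` S' \<subseteq> S'"
      using less(3) v(3) by (auto simp: S'_def sa[symmetric])
    have "v \<notin> S'" using v by (auto simp: S'_def norm_eq_1)
    moreover have "S' \<subseteq> S" by (auto simp: S'_def)
    ultimately have "S' \<subset> S" using v(1) by blast
    then have "dim S' < dim S"
      using S' less(2) by (metis dim_psubset span_eq_iff)
    from less(1)[OF this S' fS'] obtain B c where B: "finite B" "pairwise orthogonal B"
      "\<forall>v\<in>B. norm v = 1 \<and> f v = c v *\<^sub>R v" "span B = S'" by blast
    have BS': "B \<subseteq> S'" using B(4) span_superset by blast
    have "span (insert v B) = S"
    proof
      show "span (insert v B) \<subseteq> S"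
        using BS' v(1) less(2) by (intro span_minimal) (auto simp: S'_def)
      show "S \<subseteq> span (insert v B)"
      proof
        fix x assume x: "x \<in> S"
        have "x - (v \<bullet> x) *\<^sub>R v \<in> S'"
          using x v less(2) by (auto simp: S'_def subspace_diff subspace_scale inner_diff_right norm_eq_1)
        then show "x \<in> span (insert v B)"
          unfolding span_insert using B(4) by blast
      qed
    qed
    moreover have "pairwise orthogonal (insert v B)"
      using B(2) BS' by (auto simp: pairwise_insert S'_def orthogonal_def inner_commute)
    moreover have "\<forall>u\<in>insert v B. norm u = 1 \<and> f u = (c(v := c0)) u *\<^sub>R u"
      using B(3) v \<open>v \<notin> S'\<close> BS' by auto
    ultimately show ?thesis using B(1) by (intro exI[of _ "insert v B"] exI[of _ "c(v := c0)"]) auto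
  qed
qed

lemma orthonormal_expansion:
  fixes B :: "'a::euclidean_space set"
  assumes B: "finite B" "pairwise orthogonal B" "\<And>v. v \<in> B \<Longrightarrow> norm v = 1" "span B = UNIV"
  shows "x = (\<Sum>v\<in>B. (v \<bullet> x) *\<^sub>R v)"
proof -
  show ?thesis
    using orthonormal_basis_expand[OF B(2,3) _ B(1), of x] B(4) by (simp add: inner_commute)
qed

lemma inner_matrix_vector_transpose:
  "x \<bullet> (A *v y) = (transpose A *v x) \<bullet> (y :: real^'n::finite)"
  for A :: "real^'n::finite^'m::finite"
  by (metis dot_lmul_matrix transpose_matrix_vector)

text \<open>Symmetry is included, so this is exactly the condition on \<open>B\<close> inside
  \<open>psd_sqrt\<close>.\<close>

definition posdef :: "real^'m::finite^'m \<Rightarrow> bool" where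
  "posdef A \<longleftrightarrow> transpose A = A \<and> (\<forall>x. x \<noteq> 0 \<longrightarrow> 0 < x \<bullet> (A *v x))"

text \<open>The root acts diagonally on an orthonormal eigenbasis of \<open>A\<close>, by the square
  roots of the eigenvalues; these are positive because the form is positive on eigenvectors.\<close>

lemma posdef_sqrt_exists:
  fixes A :: "real^'m::finite^'m"
  assumes "posdef A"
  shows "\<exists>B. posdef B \<and> B ** B = A"
proof -
  have sym: "transpose A = A" and pos: "\<And>x. x \<noteq> 0 \<Longrightarrow> 0 < x \<bullet> (A *v x)"
    using assms by (auto simp: posdef_def)
  have "\<exists>B c. finite B \<and> pairwise orthogonal B \<and> (\<forall>v\<in>B. norm v = 1 \<and> A *v v = c v *\<^sub>R v) \<and> span B = UNIV"
    by (rule selfadjoint_orthonormal_eigenbasis_subspace)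
      (auto simp: inner_matrix_vector_transpose sym)
  then obtain E c where E: "finite E" "pairwise orthogonal E" "\<And>v. v \<in> E \<Longrightarrow> norm v = 1"
    "\<And>v. v \<in> E \<Longrightarrow> A *v v = c v *\<^sub>R v" "span E = UNIV" by blast
  have c: "0 < c v" if "v \<in> E" for v
  proof -
    have "v \<noteq> 0" using E(3)[OF that] by auto
    then have "0 < v \<bullet> (A *v v)" by (rule pos)
    then show ?thesis using E(3,4)[OF that] by (simp add: norm_eq_1)
  qed
  have EE: "u \<bullet> v = (if u = v then 1 else 0)" if "u \<in> E" "v \<in> E" for u v
    using that E(2,3) by (auto simp: pairwise_def orthogonal_def norm_eq_1)
  define h where "h x = (\<Sum>v\<in>E. (sqrt (c v) * (v \<bullet> x)) *\<^sub>R v)" for x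
  have linh: "linear h"
    unfolding h_def
    by (intro linear_compose_sum ballI linearI)
      (simp_all add: inner_add_right distrib_left scaleR_left_distrib)
  define B where "B = matrix h"
  have Bh: "B *v x = h x" for x unfolding B_def by (rule fun_cong[OF matrix_vector_mul(2)[OF linh]])
  have hu: "u \<bullet> h x = sqrt (c u) * (u \<bullet> x)" if "u \<in> E" for u x
    using that E(1) by (simp add: h_def inner_sum_right EE if_distrib cong: if_cong)
  have qf: "y \<bullet> h x = (\<Sum>v\<in>E. sqrt (c v) * (v \<bullet> x) * (v \<bullet> y))" for x y
    by (simp add: h_def inner_sum_right inner_commute)
  have "h (h x) = A *v x" for x
  proof -
    have "h (h x) = (\<Sum>v\<in>E. (c v * (v \<bullet> x)) *\<^sub>R v)"
      unfolding h_def[of "h x"] by (intro sum.cong refl) (simp add: hu c less_imp_le mult.assoc[symmetric])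
    also have "\<dots> = (\<Sum>v\<in>E. (v \<bullet> (A *v x)) *\<^sub>R v)"
      by (intro sum.cong refl) (simp add: inner_matrix_vector_transpose sym E(4))
    also have "\<dots> = A *v x" by (rule orthonormal_expansion[OF E(1-3,5), symmetric])
    finally show ?thesis .
  qed
  then have BB: "B ** B = A"
    by (simp add: matrix_eq matrix_vector_mul_assoc[symmetric] Bh)
  have "transpose B *v x = B *v x" for x
  proof -
    have "(transpose B *v x) \<bullet> y = (B *v x) \<bullet> y" for y
      unfolding inner_matrix_vector_transpose[symmetric] Bh
      by (subst inner_commute[of "h x"]) (auto simp: qf intro!: sum.cong)
    then show ?thesis using vector_eq_rdot by blast
  qed
  then have "transpose B = B" by (simp add: matrix_eq)
  moreover have "0 < x \<bullet> (B *v x)" if "x \<noteq> 0" for x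
  proof -
    have "\<exists>v\<in>E. v \<bullet> x \<noteq> 0"
    proof (rule ccontr)
      assume "\<not> (\<exists>v\<in>E. v \<bullet> x \<noteq> 0)"
      then have "(\<Sum>v\<in>E. (v \<bullet> x) *\<^sub>R v) = 0" by (intro sum.neutral) auto
      then show False using orthonormal_expansion[OF E(1-3,5), of x] that by metis
    qed
    then obtain u where u: "u \<in> E" "u \<bullet> x \<noteq> 0" by blast
    have "0 < (\<Sum>v\<in>E. sqrt (c v) * (v \<bullet> x)\<^sup>2)"
      by (rule sum_pos2[OF E(1) u(1)]) (use u c in \<open>auto simp: less_imp_le\<close>)
    then show ?thesis by (simp add: Bh qf power2_eq_square mult.assoc)
  qed
  ultimately show ?thesis using BB by (auto simp: posdef_def)
qed

lemma posdef_sqrt_unique: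
  fixes B C :: "real^'m::finite^'m"
  assumes B: "posdef B" and C: "posdef C" and eq: "B ** B = C ** C"
  shows "B = C"
proof (rule ccontr)
  assume "B \<noteq> C"
  \<comment> \<open>\<open>D = B - C\<close> satisfies \<open>B D + D C = 0\<close>, so a unit eigenvector of \<open>D\<close> with eigenvalue \<open>c\<close>
    gives \<open>c (v'Bv + v'Cv) = 0\<close>, hence \<open>c = 0\<close>.\<close>
  define D where "D = B - C"
  have symD: "transpose D = D" using B C by (simp add: D_def posdef_def transpose_def vec_eq_iff)
  have "\<exists>E c. finite E \<and> pairwise orthogonal E \<and> (\<forall>v\<in>E. norm v = 1 \<and> D *v v = c v *\<^sub>R v) \<and> span E = UNIV"
    by (rule selfadjoint_orthonormal_eigenbasis_subspace)
      (auto simp: inner_matrix_vector_transpose symD)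
  then obtain E c where E: "finite E" "pairwise orthogonal E" "\<And>v. v \<in> E \<Longrightarrow> norm v = 1"
    "\<And>v. v \<in> E \<Longrightarrow> D *v v = c v *\<^sub>R v" "span E = UNIV" by blast
  have "D *v v = 0" if v: "v \<in> E" for v
  proof -
    have "v \<bullet> (B *v (D *v v)) + v \<bullet> (D *v (C *v v)) = v \<bullet> ((B ** B - C ** C) *v v)"
      by (simp add: D_def matrix_vector_mult_diff_rdistrib matrix_vector_mult_diff_distrib
          matrix_vector_mul_assoc[symmetric] inner_diff_right)
    then have "c v * (v \<bullet> (B *v v) + v \<bullet> (C *v v)) = 0"
      using E(4)[OF v] by (simp add: eq inner_matrix_vector_transpose[of v D] symD matrix_vector_mult_scaleR distrib_left)
    moreover have "v \<noteq> 0" using E(3)[OF v] by auto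
    then have "v \<bullet> (B *v v) + v \<bullet> (C *v v) > 0"
      using B C by (auto simp: posdef_def intro: add_pos_pos)
    ultimately show ?thesis using E(4)[OF v] by simp
  qed
  then have "D *v x = 0" for x
    using linear_eq_0_on_span[of "(*v) D" E x] E(5) by auto
  then have "D = 0" by (simp add: matrix_eq)
  then show False using \<open>B \<noteq> C\<close> by (simp add: D_def)
qed

text \<open>Existence and uniqueness together give meaning to the definite description.\<close>

lemma psd_sqrt:
  assumes "posdef A"
  shows "posdef (psd_sqrt A)" "psd_sqrt A ** psd_sqrt A = A"
proof -
  have "\<exists>!B. posdef B \<and> B ** B = A"
    using posdef_sqrt_exists[OF assms] posdef_sqrt_unique by blast
  then have "posdef (psd_sqrt A) \<and> psd_sqrt A ** psd_sqrt A = A"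
    using theI'[of "\<lambda>B. posdef B \<and> B ** B = A"] by (simp add: psd_sqrt_def posdef_def conj_assoc)
  then show "posdef (psd_sqrt A)" "psd_sqrt A ** psd_sqrt A = A" by auto
qed

lemma posdef_invertible:
  assumes "posdef A" shows "invertible A"
proof -
  have "A *v x = 0 \<Longrightarrow> x = 0" for x
    using assms by (auto simp: posdef_def)
  then show ?thesis
    by (metis invertible_left_inverse matrix_left_invertible_ker)
qed

lemma matrix_inv:
  assumes "invertible A"
  shows "A ** matrix_inv A = mat 1" "matrix_inv A ** A = mat 1"
proof -
  have "A ** matrix_inv A = mat 1 \<and> matrix_inv A ** A = mat 1"
    unfolding matrix_inv_def using assms unfolding invertible_def by (rule someI_ex)
  then show "A ** matrix_inv A = mat 1" "matrix_inv A ** A = mat 1" by auto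
qed

subsection \<open>Radial shrinkage\<close>

lemma mat_plus_outer_mult:
  fixes e :: "real^'n::finite"
  shows "(\<chi> i j. (if i = j then 1 else 0) + c * e $ i * e $ j) *v x = x + (c * (e \<bullet> x)) *\<^sub>R e"
proof -
  have "(\<Sum>j\<in>UNIV. ((if i = j then 1 else 0) + c * e $ i * e $ j) * x $ j)
      = x $ i + (\<Sum>j\<in>UNIV. (c * e $ i) * (e $ j * x $ j))" for i
    by (simp add: distrib_right sum.distrib if_distrib[where f="\<lambda>y. y * _"] mult.assoc cong: if_cong)
  then show ?thesis
    by (simp add: vec_eq_iff matrix_vector_mult_def inner_vec_def sum_distrib_left[symmetric])
qed

text \<open>A rotation taking \<open>e\<close> to a multiple of a coordinate axis makes the
  perturbed identity diagonal without changing its determinant.\<close>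

lemma det_mat_plus_outer:
  fixes e :: "real^'n::finite"
  shows "det (\<chi> i j. (if i = j then 1 else 0) + c * e $ i * e $ j) = 1 + c * (e \<bullet> e)"
proof -
  let ?M = "(\<chi> i j. (if i = j then 1 else 0) + c * e $ i * e $ j) :: real^'n^'n"
  have M: "?M *v x = x + (c * (e \<bullet> x)) *\<^sub>R e" for x
    by (rule mat_plus_outer_mult)
  obtain k :: 'n where True by blast
  let ?a = "axis k (norm e) :: real^'n"
  obtain f where f: "orthogonal_transformation f" "f e = ?a"
    using orthogonal_transformation_exists[of e ?a]
    by (auto simp: norm_eq_sqrt_inner inner_axis_axis)
  define Q where "Q = matrix f"
  have fQ: "f x = Q *v x" for x
    unfolding Q_def using f(1) by (simp add: matrix_works orthogonal_transformation_linear)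
  have Q: "orthogonal_matrix Q"
    using f(1) by (simp add: Q_def orthogonal_transformation_matrix)
  then have QQ: "transpose Q ** Q = mat 1" "Q ** transpose Q = mat 1"
    by (auto simp: orthogonal_matrix_def)
  \<comment> \<open>In rotated coordinates only the axis \<open>k\<close> is stretched, by
    \<open>1 + c |e|^2\<close>.\<close>
  define D where "D = (\<chi> i j. if i = j then (if i = k then 1 + c * (e \<bullet> e) else 1) else 0 :: real^'n^'n)"
  have D: "D *v x = x + (c * (?a \<bullet> x)) *\<^sub>R ?a" for x
  proof -
    have "(D *v x) $ i = (if i = k then 1 + c * (e \<bullet> e) else 1) * x $ i" for i
      by (simp add: D_def matrix_vector_mult_def if_distrib[where f="\<lambda>y. y * _"] cong: if_cong)
    moreover have "?a \<bullet> x = norm e * x $ k" by (simp add: inner_axis')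
    moreover have "e \<bullet> e = norm e * norm e" by (simp add: norm_eq_sqrt_inner)
    ultimately show ?thesis by (simp add: vec_eq_iff axis_def algebra_simps)
  qed
  have DQ: "D *v (Q *v x) = Q *v (?M *v x)" for x
  proof -
    have lin: "linear f" using f(1) by (rule orthogonal_transformation_linear)
    have "D *v (Q *v x) = f x + (c * (f e \<bullet> f x)) *\<^sub>R f e"
      unfolding D fQ[symmetric] f(2) ..
    also have "f e \<bullet> f x = e \<bullet> x"
      using f(1) by (simp add: orthogonal_transformation_def)
    also have "f x + (c * (e \<bullet> x)) *\<^sub>R f e = Q *v (?M *v x)"
      unfolding M fQ[symmetric] by (simp only: linear_add[OF lin] linear_cmul[OF lin])
    finally show ?thesis .
  qed
  have "D ** Q = Q ** ?M"
  proof (rule iffD2[OF matrix_eq], rule allI)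
    show "(D ** Q) *v x = (Q ** ?M) *v x" for x
      using DQ[of x] by (simp only: matrix_vector_mul_assoc)
  qed
  then have "det D * det Q = det Q * det ?M"
    by (simp only: det_mul[symmetric])
  moreover have "det Q \<noteq> 0" using det_orthogonal_matrix[OF Q] by auto
  moreover have "det D = (\<Prod>i\<in>UNIV. D $ i $ i)"
    by (rule det_diagonal) (simp add: D_def)
  then have "det D = 1 + c * (e \<bullet> e)" by (simp add: D_def)
  ultimately show ?thesis by simp
qed

section \<open>Vectors in two blocks\<close>

definition vjoin :: "real^'k1::finite \<Rightarrow> real^'k2::finite \<Rightarrow> real^('k1+'k2)" where
  "vjoin x y = (\<chi> i. case i of Inl j \<Rightarrow> x $ j | Inr j \<Rightarrow> y $ j)"

lemma vparts_vjoin [simp]: "vpart1 (vjoin x y) = x" "vpart2 (vjoin x y) = y"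
  by (simp_all add: vpart1_def vpart2_def vjoin_def vec_eq_iff)

lemma vjoin_vparts [simp]: "vjoin (vpart1 z) (vpart2 z) = z"
  by (simp add: vpart1_def vpart2_def vjoin_def vec_eq_iff split: sum.split)

lemma vjoin_cases: obtains x y where "z = vjoin x y"
  using vjoin_vparts by metis

lemma bounded_linear_vpart1: "bounded_linear vpart1" and bounded_linear_vpart2: "bounded_linear vpart2"
  by (auto simp: linear_conv_bounded_linear[symmetric] linear_iff vpart1_def vpart2_def vec_eq_iff)

lemma vjoin_add: "vjoin x y + vjoin x' y' = vjoin (x + x') (y + y')"
  and vjoin_diff: "vjoin x y - vjoin x' y' = vjoin (x - x') (y - y')"
  and vjoin_scaleR: "c *\<^sub>R vjoin x y = vjoin (c *\<^sub>R x) (c *\<^sub>R y)"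
  by (simp_all add: vjoin_def vec_eq_iff split: sum.split)

lemma vjoin_eq_iff: "vjoin x y = vjoin x' y' \<longleftrightarrow> x = x' \<and> y = y'"
  by (metis vparts_vjoin)

lemma inner_vjoin: "vjoin x y \<bullet> vjoin x' y' = x \<bullet> x' + y \<bullet> y'"
  unfolding inner_vec_def UNIV_Plus_UNIV[symmetric] by (subst sum.Plus) (auto simp: vjoin_def)

lemma norm_vjoin: "(norm (vjoin x y))\<^sup>2 = (norm x)\<^sup>2 + (norm y)\<^sup>2"
  by (simp add: power2_norm_eq_inner inner_vjoin)

lemma bounded_linear_vjoin:
  assumes "bounded_linear f" "bounded_linear g"
  shows "bounded_linear (\<lambda>z::'a::euclidean_space. vjoin (f z) (g z))"
proof -
  have "linear f" "linear g" using assms by (simp_all add: bounded_linear.linear)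
  then have "linear (\<lambda>z. vjoin (f z) (g z))"
    by (intro linearI) (simp_all add: vjoin_add vjoin_scaleR linear_add linear_cmul)
  then show ?thesis by (simp add: linear_conv_bounded_linear)
qed

text \<open>The argument stands for a squared radius, which is differentiable where the norm is not.
  At \<open>r = |z2|^2\<close>, with the \<open>a\<close> and \<open>b\<close> of the model, this is
  \<open>1 - lambda_hat\<close>.\<close>

definition shrink :: "real \<Rightarrow> real \<Rightarrow> real \<Rightarrow> real" where
  "shrink a b r = inverse (1 + a * exp (- r / b))"

section \<open>The radial profile \<open>h\<close> and its inverse \<open>g\<close>\<close>

context
  fixes a b :: real
  assumes a: "0 < a" and b: "0 < b"
begin

lemma shrink_pos: "0 < shrink a b r"
  using a by (simp add: shrink_def add_pos_pos)

lemma h_fun_shrink: "h_fun a b x = shrink a b (x\<^sup>2) * x"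
  by (simp add: h_fun_def shrink_def)

text \<open>The factor \<open>shrink\<close> is positive and does not decrease with the radius, so
  multiplying it by the radius gives strict growth.\<close>

lemma h_fun_less:
  assumes "0 \<le> x" "x < y"
  shows "h_fun a b x < h_fun a b y"
proof -
  have "x\<^sup>2 / b \<le> y\<^sup>2 / b" using assms b by (intro divide_right_mono power_mono) auto
  then have "shrink a b (x\<^sup>2) \<le> shrink a b (y\<^sup>2)"
    unfolding shrink_def using a by (intro le_imp_inverse_le) (auto simp: add_pos_pos)
  then have "shrink a b (x\<^sup>2) * x \<le> shrink a b (y\<^sup>2) * x" using assms by (intro mult_right_mono) auto
  also have "\<dots> < shrink a b (y\<^sup>2) * y" using assms shrink_pos by (intro mult_strict_left_mono) auto
  finally show ?thesis by (simp add: h_fun_shrink)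
qed

text \<open>Since \<open>shrink a b r \<ge> 1 / (1 + a)\<close> for \<open>r \<ge> 0\<close>, the
  value of \<open>h_fun\<close> at \<open>y * (1 + a)\<close> is at least \<open>y\<close>, and the
  intermediate value theorem applies.\<close>

lemma h_fun_surj:
  assumes "0 \<le> y"
  shows "\<exists>x\<ge>0. h_fun a b x = y"
proof -
  have "y = y * (1 + a) * inverse (1 + a)" using a by (simp add: field_simps)
  also have "\<dots> \<le> y * (1 + a) * shrink a b ((y * (1 + a))\<^sup>2)"
    unfolding shrink_def using a b assms
    by (intro mult_left_mono le_imp_inverse_le) (auto simp: add_pos_pos)
  finally have "y \<le> h_fun a b (y * (1 + a))"
    by (simp only: h_fun_shrink mult.commute)
  moreover have "continuous_on {0..y * (1 + a)} (h_fun a b)"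
    unfolding h_fun_def using a b
    by (intro continuous_intros) (auto simp: add_pos_pos pos_add_strict less_imp_neq[symmetric])
  ultimately show ?thesis
    using IVT'[of "h_fun a b" 0 y "y * (1 + a)"] a assms by (auto simp: h_fun_def)
qed

lemma g_fun_h_fun:
  assumes "0 \<le> x" shows "g_fun a b (h_fun a b x) = x"
  unfolding g_fun_def
proof (rule the_equality)
  fix y assume "0 \<le> y \<and> h_fun a b y = h_fun a b x"
  then show "y = x" using h_fun_less[of x y] h_fun_less[of y x] assms by (metis less_irrefl linorder_neqE)
qed (use assms in auto)

lemma h_fun_g_fun:
  assumes "0 \<le> y" shows "0 \<le> g_fun a b y" "h_fun a b (g_fun a b y) = y"
  using h_fun_surj[OF assms] g_fun_h_fun by auto

text \<open>The inverse of an increasing function is monotone, hence Borel; composing with a norm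
  keeps the arguments in the range of \<open>h_fun\<close>.\<close>

lemma borel_measurable_g_fun_norm:
  assumes [measurable]: "f \<in> borel_measurable M"
  shows "(\<lambda>x. g_fun a b (norm (f x :: 'c::euclidean_space))) \<in> borel_measurable M"
proof -
  \<comment> \<open>Clipping at 0 gives a function that is monotone on the whole line: below 0 the
    description in \<open>g_fun\<close> has no witness.\<close>
  define g where "g y = g_fun a b (max 0 y)" for y
  have "g x \<le> g y" if "x \<le> y" for x y
  proof (rule ccontr)
    assume "\<not> g x \<le> g y"
    then have "h_fun a b (g y) < h_fun a b (g x)"
      by (intro h_fun_less) (auto simp: g_def h_fun_g_fun)
    then show False using that by (auto simp: g_def h_fun_g_fun max_def split: if_splits)
  qed
  then have [measurable]: "g \<in> borel_measurable borel"
    by (intro borel_measurable_mono) (simp add: mono_def)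
  have "(\<lambda>x. g_fun a b (norm (f x))) = (\<lambda>x. g (norm (f x)))" by (simp add: g_def)
  then show ?thesis by simp
qed

section \<open>The shrinkage map: bijectivity, derivative, Jacobian\<close>

definition shrink_map :: "real^('k1::finite+'k2::finite) \<Rightarrow> real^('k1+'k2)" where
  "shrink_map z = vjoin (vpart1 z) (shrink a b ((norm (vpart2 z))\<^sup>2) *\<^sub>R vpart2 z)"

lemma norm_shrink_scaleR: "norm (shrink a b ((norm v)\<^sup>2) *\<^sub>R v) = h_fun a b (norm v)"
  using shrink_pos by (simp add: h_fun_shrink abs_of_pos)

text \<open>The left side has the shape of \<open>Gw\<close> in \<open>dens\<close>, including the
  convention at zero, so at image points \<open>Gw\<close> turns back into the unshrunken
  vector.\<close>

lemma shrink_left_inverse: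
  fixes v :: "'c::real_normed_vector"
  defines "w \<equiv> shrink a b ((norm v)\<^sup>2) *\<^sub>R v"
  shows "(if w = 0 then 0 else (g_fun a b (norm w) / norm w) *\<^sub>R w) = v"
proof -
  have g: "g_fun a b (norm w) = norm v"
    unfolding w_def norm_shrink_scaleR by (simp add: g_fun_h_fun)
  have "w = 0 \<longleftrightarrow> v = 0" using shrink_pos[of "(norm v)\<^sup>2"] by (simp add: w_def)
  then show ?thesis
    using shrink_pos[of "(norm v)\<^sup>2"] unfolding g by (auto simp: w_def)
qed

lemma inj_shrink_map: "inj (shrink_map :: real^('k1::finite+'k2::finite) \<Rightarrow> _)"
proof (rule injI)
  fix y z :: "real^('k1+'k2)" assume "shrink_map y = shrink_map z"
  then have "vpart1 y = vpart1 z" and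
    *: "shrink a b ((norm (vpart2 y))\<^sup>2) *\<^sub>R vpart2 y = shrink a b ((norm (vpart2 z))\<^sup>2) *\<^sub>R vpart2 z"
    by (auto simp: shrink_map_def vjoin_eq_iff)
  moreover have "vpart2 y = vpart2 z"
    using shrink_left_inverse[of "vpart2 y"] shrink_left_inverse[of "vpart2 z"] unfolding * by simp
  ultimately show "y = z" by (metis vjoin_vparts)
qed

lemma surj_shrink_map: "surj (shrink_map :: real^('k1::finite+'k2::finite) \<Rightarrow> _)"
proof (rule surjI)
  fix z :: "real^('k1+'k2)"
  let ?w = "vpart2 z"
  \<comment> \<open>The preimage keeps the direction of \<open>?w\<close> and gets the radius
    prescribed by \<open>g_fun\<close>; for \<open>?w = 0\<close> it is the zero vector.\<close>
  let ?v = "(g_fun a b (norm ?w) / norm ?w) *\<^sub>R ?w"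
  have "shrink a b ((norm ?v)\<^sup>2) *\<^sub>R ?v = ?w"
  proof (cases "?w = 0")
    case False
    then have nv: "norm ?v = g_fun a b (norm ?w)" by (simp add: h_fun_g_fun)
    have "shrink a b ((g_fun a b (norm ?w))\<^sup>2) * g_fun a b (norm ?w) = norm ?w"
      using h_fun_g_fun(2)[of "norm ?w"] by (simp add: h_fun_shrink)
    then show ?thesis using False by (simp add: nv)
  qed simp
  then show "shrink_map (vjoin (vpart1 z) ?v) = z" by (simp add: shrink_map_def)
qed

text \<open>Product rule for \<open>s(|z2|^2) z2\<close>: the factor 2 and the inner product come
  from the squared norm, and \<open>s\<^sup>2 * (a * exp (- r / b) / b)\<close> is the derivative of
  \<open>shrink a b\<close> at \<open>r\<close>.\<close>

definition shrink_deriv :: "real^('k1::finite+'k2::finite) \<Rightarrow> real^('k1+'k2) \<Rightarrow> real^('k1+'k2)" where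
  "shrink_deriv z d = (let r = (norm (vpart2 z))\<^sup>2; s = shrink a b r in
     vjoin (vpart1 d) (s *\<^sub>R vpart2 d + (2 * (s\<^sup>2 * (a * exp (- r / b) / b)) * (vpart2 z \<bullet> vpart2 d)) *\<^sub>R vpart2 z))"

lemma shrink_has_field_derivative:
  "(shrink a b has_real_derivative (shrink a b r)\<^sup>2 * (a * exp (- r / b) / b)) (at r)"
proof -
  have "1 + a * exp (- r / b) \<noteq> 0" using a by (metis add_pos_pos exp_gt_zero less_irrefl mult_pos_pos zero_less_one)
  then show ?thesis
    unfolding shrink_def[abs_def] using b
    by (auto intro!: derivative_eq_intros simp: power2_eq_square field_simps)
qed

lemma shrink_map_has_derivative:
  "(shrink_map has_derivative shrink_deriv z) (at (z :: real^('a::finite+'b::finite)))"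
proof -
  define r where "r = vpart2 z \<bullet> vpart2 z"
  define q where "q = (shrink a b r)\<^sup>2 * (a * exp (- r / b) / b)"
  have v: "(vpart2 has_derivative vpart2) (at z)"
    by (rule bounded_linear_imp_has_derivative[OF bounded_linear_vpart2])
  have "((\<lambda>z. vpart2 z \<bullet> vpart2 z) has_derivative (\<lambda>d. vpart2 z \<bullet> vpart2 d + vpart2 d \<bullet> vpart2 z)) (at z)"
    by (rule has_derivative_inner[OF v v])
  moreover have "(shrink a b has_derivative (\<lambda>x. x * ((shrink a b r)\<^sup>2 * (a * exp (- r / b) / b)))) (at r)" for r
    using shrink_has_field_derivative[unfolded has_field_derivative_def]
    by (rule has_derivative_eq_rhs) (simp add: fun_eq_iff)
  ultimately have "((\<lambda>z. shrink a b (vpart2 z \<bullet> vpart2 z)) has_derivative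
     (\<lambda>d. (vpart2 z \<bullet> vpart2 d + vpart2 d \<bullet> vpart2 z) * q)) (at z)"
    unfolding q_def r_def by (rule has_derivative_compose)
  then have "((\<lambda>z. shrink a b (vpart2 z \<bullet> vpart2 z)) has_derivative (\<lambda>d. 2 * q * (vpart2 z \<bullet> vpart2 d))) (at z)"
    by (rule has_derivative_eq_rhs) (auto simp: inner_commute)
  from has_derivative_scaleR[OF this v]
  have 2: "((\<lambda>z. shrink a b (vpart2 z \<bullet> vpart2 z) *\<^sub>R vpart2 z) has_derivative
     (\<lambda>d. shrink a b r *\<^sub>R vpart2 d + (2 * q * (vpart2 z \<bullet> vpart2 d)) *\<^sub>R vpart2 z)) (at z)"
    unfolding r_def .
  have 1: "(vpart1 has_derivative vpart1) (at z)"
    by (rule bounded_linear_imp_has_derivative[OF bounded_linear_vpart1])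
  have "bounded_linear (\<lambda>p::(real^'a) \<times> (real^'b). vjoin (fst p) (snd p))"
    by (intro bounded_linear_vjoin bounded_linear_fst bounded_linear_snd)
  from bounded_linear.has_derivative[OF this has_derivative_Pair[OF 1 2]]
  show ?thesis
    unfolding shrink_map_def[abs_def] shrink_deriv_def[abs_def] power2_norm_eq_inner Let_def
    by (simp only: fst_conv snd_conv r_def q_def)
qed

lemma det_shrink_deriv:
  fixes z :: "real^('k1::finite+'k2::finite)"
  defines "r \<equiv> (norm (vpart2 z))\<^sup>2"
  shows "det (matrix (shrink_deriv z)) =
    (shrink a b r) ^ CARD('k2) * (1 + 2 * (shrink a b r * (a * exp (- r / b) / b)) * r)"
proof -
  define s where "s = shrink a b r"
  \<comment> \<open>One factor \<open>s\<close> fewer than in \<open>shrink_deriv\<close>: the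
    diagonal matrix \<open>D\<close> supplies it on the second block.\<close>
  define c where "c = 2 * (s * (a * exp (- r / b) / b))"
  define e where "e = vjoin (0 :: real^'k1) (vpart2 z)"
  let ?M = "(\<chi> i j. (if i = j then 1 else 0) + c * e $ i * e $ j) :: real^('k1+'k2)^('k1+'k2)"
  define D :: "real^('k1+'k2)^('k1+'k2)"
    where "D = (\<chi> i j. if i = j then (case i of Inl _ \<Rightarrow> 1 | Inr _ \<Rightarrow> s) else 0)"
  have M: "?M *v x = x + (c * (e \<bullet> x)) *\<^sub>R e" for x
    by (rule mat_plus_outer_mult)
  have D: "D *v x = vjoin (vpart1 x) (s *\<^sub>R vpart2 x)" for x
  proof -
    have "(D *v x) $ i = (case i of Inl _ \<Rightarrow> 1 | Inr _ \<Rightarrow> s) * x $ i" for i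
      by (simp add: D_def matrix_vector_mult_def if_distrib[where f="\<lambda>y. y * _"] cong: if_cong)
    then show ?thesis
      by (simp add: vec_eq_iff vjoin_def vpart1_def vpart2_def split: sum.split)
  qed
  have "shrink_deriv z x = (D ** ?M) *v x" for x
  proof -
    obtain x1 x2 where x: "x = vjoin x1 x2" by (rule vjoin_cases)
    have "(D ** ?M) *v x = vjoin (vpart1 (x + (c * (e \<bullet> x)) *\<^sub>R e)) (s *\<^sub>R vpart2 (x + (c * (e \<bullet> x)) *\<^sub>R e))"
      by (simp only: matrix_vector_mul_assoc[symmetric] M D)
    also have "\<dots> = shrink_deriv z x"
      by (simp add: shrink_deriv_def Let_def x e_def vjoin_add vjoin_scaleR inner_vjoin c_def
          r_def[symmetric] s_def[symmetric] scaleR_add_right power2_eq_square[of s] mult.assoc mult.left_commute)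
    finally show ?thesis ..
  qed
  then have "matrix (shrink_deriv z) = matrix ((*v) (D ** ?M))" by presburger
  then have "det (matrix (shrink_deriv z)) = det D * det ?M"
    by (simp only: matrix_of_matrix_vector_mul det_mul)
  also have "det ?M = 1 + c * r"
    by (simp only: det_mat_plus_outer) (simp add: e_def inner_vjoin r_def power2_norm_eq_inner)
  also have "det D = (\<Prod>i\<in>UNIV. D $ i $ i)"
    by (rule det_diagonal) (simp add: D_def)
  also have "\<dots> = s ^ CARD('k2)"
    unfolding UNIV_Plus_UNIV[symmetric] by (subst prod.Plus) (auto simp: D_def)
  finally show ?thesis by (simp add: c_def s_def)
qed

end

subsection \<open>Whitening coordinates for the regression model\<close>

lemma matrix_diff_left: "A ** (B - C) = A ** B - A ** C"
  and matrix_diff_right: "(D - E) ** F = D ** F - E ** F"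
  for A D E :: "real^'n::finite^'m::finite"
  by (simp_all add: matrix_matrix_mult_def vec_eq_iff right_diff_distrib left_diff_distrib sum_subtractf)

text \<open>Polarisation: norms determine inner products, and these determine the Gram
  matrix.\<close>

lemma gram_eqI:
  fixes A :: "real^'n::finite^'m::finite" and B :: "real^'n^'k::finite"
  assumes "\<And>u. norm (A *v u) = norm (B *v u)"
  shows "transpose A ** A = transpose B ** B"
proof -
  have "(A *v u) \<bullet> (A *v v) = (B *v u) \<bullet> (B *v v)" for u v
    using assms[of "u + v"] by (simp add: dot_norm assms matrix_vector_right_distrib[symmetric])
  then have "u \<bullet> ((transpose A ** A) *v v) = u \<bullet> ((transpose B ** B) *v v)" for u v
    by (simp add: matrix_vector_mul_assoc[symmetric] inner_matrix_vector_transpose del: transpose_matrix_vector)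
  then have "(transpose A ** A) *v v = (transpose B ** B) *v v" for v
    using vector_eq_ldot by blast
  then show ?thesis by (simp add: matrix_eq)
qed

lemma inner_gram: "x \<bullet> ((transpose A ** A) *v x) = (norm (A *v x))\<^sup>2"
  for A :: "real^'n::finite^'m::finite"
  by (simp add: matrix_vector_mul_assoc[symmetric] inner_matrix_vector_transpose power2_norm_eq_inner
      del: transpose_matrix_vector)

lemma posdef_gram:
  fixes A :: "real^'n::finite^'m::finite"
  assumes "\<And>x. A *v x = 0 \<Longrightarrow> x = 0"
  shows "posdef (transpose A ** A)"
  unfolding posdef_def inner_gram using assms by (auto simp: matrix_transpose_mul)

lemma norm_psd_sqrt_mult:
  assumes "posdef A" shows "(norm (psd_sqrt A *v x))\<^sup>2 = x \<bullet> (A *v x)"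
  using inner_gram[of x "psd_sqrt A"] psd_sqrt[OF assms] by (simp add: posdef_def)

lemma mult_vjoin:
  "X *v vjoin x y = blk1 X *v x + blk2 X *v y"
  unfolding vec_eq_iff matrix_vector_mult_def UNIV_Plus_UNIV[symmetric]
  by (subst sum.Plus) (auto simp: blk1_def blk2_def vjoin_def)

text \<open>The least squares coefficients of the columns of \<open>X2\<close> on \<open>X1\<close>,
  so that \<open>X1 ** coef X\<close> is \<open>P_R X2\<close>.\<close>

definition coef :: "real^('k1::finite+'k2::finite)^'n::finite \<Rightarrow> real^'k2^'k1" where
  "coef X = matrix_inv (transpose (blk1 X) ** blk1 X) ** (transpose (blk1 X) ** blk2 X)"

definition whiten :: "real^('k1::finite+'k2::finite)^'n::finite \<Rightarrow> real^('k1+'k2)^('k1+'k2)" where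
  "whiten X = matrix (\<lambda>u. vjoin
      (psd_sqrt (transpose (blk1 X) ** blk1 X) *v (vpart1 u + coef X *v vpart2 u))
      (psd_sqrt (transpose (blk2 X) ** (mat 1 - blk1 X ** matrix_inv (transpose (blk1 X) ** blk1 X) ** transpose (blk1 X)) ** blk2 X) *v vpart2 u))"

lemma whiten_mult:
  "whiten X *v u = vjoin
      (psd_sqrt (transpose (blk1 X) ** blk1 X) *v (vpart1 u + coef X *v vpart2 u))
      (psd_sqrt (transpose (blk2 X) ** (mat 1 - blk1 X ** matrix_inv (transpose (blk1 X) ** blk1 X) ** transpose (blk1 X)) ** blk2 X) *v vpart2 u)"
proof -
  have "linear (\<lambda>u. vjoin
      (psd_sqrt (transpose (blk1 X) ** blk1 X) *v (vpart1 u + coef X *v vpart2 u))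
      (psd_sqrt (transpose (blk2 X) ** (mat 1 - blk1 X ** matrix_inv (transpose (blk1 X) ** blk1 X) ** transpose (blk1 X)) ** blk2 X) *v vpart2 u))"
    unfolding linear_conv_bounded_linear
    by (intro bounded_linear_vjoin bounded_linear_add bounded_linear_vpart1 bounded_linear_vpart2
        bounded_linear_compose[OF matrix_vector_mul_bounded_linear])
  from fun_cong[OF matrix_vector_mul(2)[OF this]] show ?thesis unfolding whiten_def .
qed

section \<open>Orthogonal decomposition of the regression and the whitened estimators\<close>

context
  fixes X :: "real^('k1::finite+'k2::finite)^'n::finite"
  assumes full_rank: "rank X = CARD('k1+'k2)"
begin

abbreviation "X1 \<equiv> blk1 X"
abbreviation "X2 \<equiv> blk2 X"
abbreviation "S1 \<equiv> transpose X1 ** X1"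
abbreviation "S2 \<equiv> transpose X2 ** (mat 1 - X1 ** matrix_inv S1 ** transpose X1) ** X2"

text \<open>This is \<open>(I - P_R) X2\<close>, the part of \<open>X2\<close> orthogonal to the
  columns of \<open>X1\<close>.\<close>

definition "resid = X2 - X1 ** coef X"

lemma X_inj: "X *v u = 0 \<Longrightarrow> u = 0"
  using full_rank unfolding full_rank_injective by (metis injD matrix_vector_mult_0_right)

lemma posdef_S1: "posdef S1"
proof (rule posdef_gram)
  fix x assume "X1 *v x = 0"
  then have "X *v vjoin x 0 = 0" by (simp add: mult_vjoin)
  from X_inj[OF this] show "x = 0" by (metis vparts_vjoin(1) vjoin_scaleR scaleR_zero_left)
qed

lemma S1_inv: "S1 ** matrix_inv S1 = mat 1" "matrix_inv S1 ** S1 = mat 1"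
  using matrix_inv posdef_invertible[OF posdef_S1] by auto

lemma X_mult: "X *v u = X1 *v (vpart1 u + coef X *v vpart2 u) + resid *v vpart2 u"
proof -
  have "X *v vjoin (vpart1 u) (vpart2 u) = X1 *v (vpart1 u + coef X *v vpart2 u) + resid *v vpart2 u"
    unfolding mult_vjoin
    by (simp add: resid_def matrix_vector_right_distrib matrix_vector_mult_diff_rdistrib matrix_vector_mul_assoc)
  then show ?thesis by simp
qed

lemma X1_resid: "transpose X1 ** resid = 0"
proof -
  have "transpose X1 ** resid = transpose X1 ** X2 - S1 ** coef X"
    by (simp add: resid_def matrix_diff_left matrix_mul_assoc)
  also have "S1 ** coef X = transpose X1 ** X2"
    unfolding coef_def by (metis S1_inv(1) matrix_mul_assoc matrix_mul_lid)
  finally show ?thesis by simp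
qed

text \<open>The product \<open>X2' resid\<close> becomes \<open>resid' resid\<close> because the
  difference of \<open>X2\<close> and \<open>resid\<close> lies in the column space of
  \<open>X1\<close>, to which \<open>resid\<close> is orthogonal.\<close>

lemma S2_eq: "S2 = transpose resid ** resid"
proof -
  have "S2 = transpose X2 ** resid"
    by (simp add: resid_def coef_def matrix_diff_left matrix_diff_right matrix_mul_assoc)
  also have "\<dots> = transpose resid ** resid"
  proof -
    have "transpose resid = transpose X2 - transpose (coef X) ** transpose X1"
      by (simp add: resid_def transpose_def matrix_matrix_mult_def vec_eq_iff mult.commute)
    then show ?thesis
      by (simp add: matrix_diff_right matrix_mul_assoc[symmetric] X1_resid)
  qed
  finally show ?thesis .
qed

lemma posdef_S2: "posdef S2"
  unfolding S2_eq
proof (rule posdef_gram)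
  fix y assume "resid *v y = 0"
  \<comment> \<open>A kernel vector of \<open>resid\<close> extends to one of \<open>X\<close>: the
    first block is chosen to cancel \<open>coef X *v y\<close>.\<close>
  then have "X *v vjoin (- (coef X *v y)) y = 0" by (simp add: X_mult)
  from X_inj[OF this] show "y = 0" by (metis vparts_vjoin(2) vjoin_scaleR scaleR_zero_left)
qed

text \<open>Pythagoras for the splitting in \<open>X_mult\<close>; the two symmetric roots reproduce
  the lengths of its two orthogonal parts.\<close>

lemma norm_whiten: "norm (whiten X *v u) = norm (X *v u)"
proof -
  let ?x = "vpart1 u + coef X *v vpart2 u" and ?y = "vpart2 u"
  have "(X1 *v ?x) \<bullet> (resid *v ?y) = ?x \<bullet> ((transpose X1 ** resid) *v ?y)"
    by (simp add: inner_matrix_vector_transpose[of _ "transpose X1"] matrix_vector_mul_assoc[symmetric]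
        del: transpose_matrix_vector)
  then have "(norm (X *v u))\<^sup>2 = (norm (X1 *v ?x))\<^sup>2 + (norm (resid *v ?y))\<^sup>2"
    unfolding X_mult by (simp add: X1_resid power2_norm_eq_inner inner_add_left inner_add_right inner_commute)
  also have "\<dots> = (norm (whiten X *v u))\<^sup>2"
    unfolding whiten_mult norm_vjoin norm_psd_sqrt_mult[OF posdef_S1] norm_psd_sqrt_mult[OF posdef_S2]
    unfolding S2_eq by (simp only: inner_gram)
  finally show ?thesis by simp
qed

lemma whiten_gram: "transpose (whiten X) ** whiten X = transpose X ** X"
  by (rule gram_eqI) (rule norm_whiten)

lemma posdef_gram_X: "posdef (transpose X ** X)"
  by (rule posdef_gram) (rule X_inj)

lemma whiten_invertible: "invertible (whiten X)"
  unfolding invertible_left_inverse matrix_left_invertible_ker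
  using norm_whiten X_inj by (metis norm_eq_zero)

lemma normal_equation: "(transpose X ** X) *v beta_U X Y = transpose X *v Y"
  using matrix_inv[OF posdef_invertible[OF posdef_gram_X]]
  by (simp add: beta_U_def matrix_vector_mul_assoc)

text \<open>The first block of the normal equations, with the \<open>resid\<close> part removed by
  orthogonality, expresses the restricted estimator through the unrestricted one. Its first block is
  the combination that \<open>whiten\<close> uses.\<close>

lemma beta_R_eq: "beta_R X Y = vjoin (vpart1 (beta_U X Y) + coef X *v vpart2 (beta_U X Y)) 0"
proof -
  let ?u = "beta_U X Y"
  have "vpart1 (transpose X *v (X *v ?u)) = vpart1 (transpose X *v Y)"
    using normal_equation by (simp add: matrix_vector_mul_assoc)
  then have "transpose X1 *v (X *v ?u) = transpose X1 *v Y"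
    by (simp add: vpart1_def blk1_def transpose_def matrix_vector_mult_def)
  moreover have "transpose X1 *v (X *v ?u) = S1 *v (vpart1 ?u + coef X *v vpart2 ?u)"
  proof -
    have "transpose X1 *v (resid *v vpart2 ?u) = 0"
      by (simp add: matrix_vector_mul_assoc X1_resid del: transpose_matrix_vector)
    then show ?thesis
      unfolding X_mult matrix_vector_right_distrib
      by (simp add: matrix_vector_mul_assoc matrix_mul_assoc del: transpose_matrix_vector)
  qed
  ultimately have "matrix_inv S1 *v (transpose X1 *v Y) = (matrix_inv S1 ** S1) *v (vpart1 ?u + coef X *v vpart2 ?u)"
    by (simp add: matrix_vector_mul_assoc[symmetric])
  then show ?thesis
    by (simp add: S1_inv beta_R_def vjoin_def vec_eq_iff split: sum.split)
qed

definition "whitened_ls = whiten X ** matrix_inv (transpose X ** X) ** transpose X"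

lemma whitened_ls_mult: "whitened_ls *v Y = whiten X *v beta_U X Y"
  by (simp add: whitened_ls_def beta_U_def matrix_vector_mul_assoc matrix_mul_assoc del: transpose_matrix_vector)

text \<open>With \<open>B = whiten X\<close>, the matrix \<open>N = B (X'X)^(-1)\<close> inverts
  \<open>B'\<close> because \<open>B'B = X'X\<close>; hence \<open>N (X'X) = B\<close>, from which
  both claims follow.\<close>

lemma whitened_ls_orthonormal: "whitened_ls ** transpose whitened_ls = mat 1"
  and whitened_ls_mean: "whitened_ls *v (X *v \<beta>) = whiten X *v \<beta>"
proof -
  define N where "N = whiten X ** matrix_inv (transpose X ** X)"
  have L: "whitened_ls = N ** transpose X" by (simp add: whitened_ls_def N_def)
  have "transpose (whiten X) ** N = mat 1"
    unfolding N_def matrix_mul_assoc whiten_gram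
    by (rule matrix_inv[OF posdef_invertible[OF posdef_gram_X]])
  then have N: "N ** transpose (whiten X) = mat 1" by (simp add: matrix_left_right_inverse)
  have XX: "N ** (transpose X ** X) = whiten X"
    unfolding whiten_gram[symmetric] matrix_mul_assoc N by simp
  have "whitened_ls ** transpose whitened_ls = N ** (transpose X ** X) ** transpose N"
    by (simp add: L matrix_transpose_mul matrix_mul_assoc)
  also have "\<dots> = transpose (N ** transpose (whiten X))"
    unfolding XX by (simp add: matrix_transpose_mul)
  finally show "whitened_ls ** transpose whitened_ls = mat 1" by (simp add: N)
  show "whitened_ls *v (X *v \<beta>) = whiten X *v \<beta>"
    unfolding L XX[symmetric] by (simp only: matrix_vector_mul_assoc matrix_mul_assoc)
qed

lemma whiten_beta_tilde:
  assumes \<sigma>: "0 < \<sigma>" and \<alpha>: "0 < \<alpha>"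
  shows "whiten X *v beta_tilde \<alpha> \<sigma> X Y =
    shrink_map (exp (2 * \<alpha> * real CARD('k2))) (\<sigma>\<^sup>2 / \<alpha>) (whiten X *v beta_U X Y)"
proof -
  define a where "a = exp (2 * \<alpha> * real CARD('k2))"
  define b where "b = \<sigma>\<^sup>2 / \<alpha>"
  have ab: "0 < a" "0 < b" using assms by (auto simp: a_def b_def)
  define z where "z = whiten X *v beta_U X Y"
  define l where "l = lambda_hat \<alpha> \<sigma> X Y"
  have R: "whiten X *v beta_R X Y = vjoin (vpart1 z) 0"
    unfolding beta_R_eq z_def whiten_mult by (simp add: whiten_mult)
  obtain z1 z2 where z: "z = vjoin z1 z2" by (rule vjoin_cases)
  \<comment> \<open>Whitening preserves \<open>|X u|\<close>, and the two whitened estimators differ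
    only in the second block.\<close>
  have "norm (X *v beta_R X Y - X *v beta_U X Y) = norm (whiten X *v beta_R X Y - whiten X *v beta_U X Y)"
    using norm_whiten[of "beta_R X Y - beta_U X Y"] by (simp add: matrix_vector_mult_diff_distrib)
  also have "\<dots> = norm (vjoin (0::real^'k1) (- vpart2 z))"
    unfolding R z_def[symmetric] by (simp add: z vjoin_diff)
  finally have "(norm (X *v beta_R X Y - X *v beta_U X Y))\<^sup>2 = (norm (vpart2 z))\<^sup>2"
    by (simp add: norm_vjoin)
  then have "l = inverse (1 + inverse (a * exp (- (norm (vpart2 z))\<^sup>2 / b)))"
    unfolding l_def lambda_hat_def a_def b_def
    by (simp add: exp_minus[symmetric] mult_exp_exp algebra_simps)
  \<comment> \<open>The complement of a logistic weight is logistic with inverted odds; it is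
    applied to \<open>a exp(-r/b)\<close> with \<open>r = |z2|^2\<close>.\<close>
  moreover have "1 - inverse (1 + inverse E) = inverse (1 + E)" if "0 < E" for E :: real
    using that by (simp add: divide_simps)
  moreover have "0 < a * exp (- (norm (vpart2 z))\<^sup>2 / b)" using ab by simp
  ultimately have l: "1 - l = shrink a b ((norm (vpart2 z))\<^sup>2)"
    unfolding shrink_def by presburger
  have "whiten X *v beta_tilde \<alpha> \<sigma> X Y = l *\<^sub>R vjoin (vpart1 z) 0 + (1 - l) *\<^sub>R z"
    unfolding beta_tilde_def l_def[symmetric]
    by (simp add: matrix_vector_right_distrib matrix_vector_mult_scaleR R z_def)
  also have "\<dots> = shrink_map a b z"
    unfolding shrink_map_def[OF ab] l[symmetric]
    by (simp add: z vjoin_add vjoin_scaleR scaleR_add_left[symmetric])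
  finally show ?thesis by (simp add: a_def b_def z_def)
qed


text \<open>\<open>whiten\<close> produces the left side and \<open>dens\<close> displays the right
  one; they agree because the root squares to \<open>S1\<close>.\<close>

lemma psd_sqrt_S1_coef: "psd_sqrt S1 ** coef X = matrix_inv (psd_sqrt S1) ** (transpose X1 ** X2)"
proof -
  let ?R = "psd_sqrt S1"
  have R: "matrix_inv ?R ** ?R = mat 1" "?R ** ?R = S1"
    using matrix_inv[OF posdef_invertible] psd_sqrt[OF posdef_S1] by auto
  have "?R ** matrix_inv S1 = (matrix_inv ?R ** ?R) ** (?R ** matrix_inv S1)"
    by (simp add: R)
  also have "\<dots> = matrix_inv ?R ** ((?R ** ?R) ** matrix_inv S1)"
    by (simp only: matrix_mul_assoc)
  also have "\<dots> = matrix_inv ?R" by (simp add: R(2) S1_inv)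
  finally show ?thesis by (simp only: coef_def matrix_mul_assoc)
qed

text \<open>At \<open>t = sqrt n (beta_tilde - \<beta>)\<close> the vector
  \<open>C t + B \<beta>\<close>, with \<open>B = whiten X\<close>, equals
  \<open>B beta_tilde\<close>, so \<open>w\<close> is its second block, the shrunken one. This form
  is ready for evaluation at image points.\<close>

lemma dens_eq:
  fixes t \<beta> :: "real^('k1+'k2)" and \<alpha> \<sigma> :: real
  defines "n \<equiv> real CARD('n)" and "a \<equiv> exp (2 * \<alpha> * real CARD('k2))" and "b \<equiv> \<sigma>\<^sup>2 / \<alpha>"
  defines "C \<equiv> (1 / sqrt n) *\<^sub>R whiten X"
  defines "w \<equiv> vpart2 (C *v t + whiten X *v \<beta>)"
  defines "G \<equiv> g_fun a b (norm w)"
  shows "dens \<alpha> \<sigma> X \<beta> t =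
     (2 * pi * \<sigma>\<^sup>2) powr (- real CARD('k1+'k2) / 2) * sqrt (det ((1 / n) *\<^sub>R (transpose X ** X)))
       * exp (- (norm (vpart1 (C *v t)))\<^sup>2 / (2 * \<sigma>\<^sup>2))
       * (1 + exp (- \<alpha> / \<sigma>\<^sup>2 * G\<^sup>2 + 2 * \<alpha> * real CARD('k2))) ^ CARD('k2)
       * inverse (1 + 2 * \<alpha> / \<sigma>\<^sup>2 * G\<^sup>2 * inverse (1 + exp (\<alpha> / \<sigma>\<^sup>2 * G\<^sup>2 - 2 * \<alpha> * real CARD('k2))))
       * exp (- (norm ((if w = 0 then 0 else (G / norm w) *\<^sub>R w) - vpart2 (whiten X *v \<beta>)))\<^sup>2 / (2 * \<sigma>\<^sup>2))"
proof -
  have n: "0 < n" by (simp add: n_def)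
  have v2: "vpart2 (x + y) = vpart2 x + vpart2 y" "vpart2 (c *\<^sub>R x) = c *\<^sub>R vpart2 x"
    "vpart1 (c *\<^sub>R x) = c *\<^sub>R vpart1 x" for x y :: "real^('k1+'k2)" and c
    by (simp_all add: vpart2_def vpart1_def vec_eq_iff)
  have w: "w = (1 / sqrt n) *\<^sub>R (psd_sqrt S2 *v (vpart2 t + sqrt n *\<^sub>R vpart2 \<beta>))"
    using n by (simp add: w_def C_def scaleR_matrix_vector_assoc[symmetric] v2 whiten_mult
        matrix_vector_right_distrib matrix_vector_mult_scaleR scaleR_add_right)
  have 1: "vpart1 (C *v t) = (1 / sqrt n) *\<^sub>R (psd_sqrt S1 *v vpart1 t)
      + (1 / sqrt n) *\<^sub>R (matrix_inv (psd_sqrt S1) *v (transpose X1 *v (X2 *v vpart2 t)))"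
    unfolding matrix_vector_mul_assoc matrix_mul_assoc[symmetric] psd_sqrt_S1_coef[symmetric]
    by (simp add: C_def scaleR_matrix_vector_assoc[symmetric] v2 whiten_mult
        matrix_vector_right_distrib scaleR_add_right matrix_vector_mul_assoc)
  have 2: "vpart2 (whiten X *v \<beta>) = psd_sqrt S2 *v vpart2 \<beta>"
    by (simp add: whiten_mult)
  show ?thesis
    unfolding dens_def Let_def 1 2 w[symmetric, unfolded n_def] G_def a_def b_def n_def ..
qed

end

section \<open>Density of the scaled estimation error\<close>

theorem theorem3:
  fixes X :: "real^('k1::finite+'k2::finite)^'n::finite" and \<beta> :: "real^('k1::finite+'k2::finite)" and \<sigma> \<alpha> :: real
  assumes "rank X = CARD('k1+'k2)"
    and "0 < \<sigma>" and "0 < \<alpha>"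
  shows "distr (model_distr X \<beta> \<sigma>) lborel
           (\<lambda>Y. sqrt (real CARD('n)) *\<^sub>R (beta_tilde \<alpha> \<sigma> X Y - \<beta>))
         = density lborel (\<lambda>t. ennreal (dens \<alpha> \<sigma> X \<beta> t))"
proof -
  note rk = assms(1) and \<sigma> = assms(2) and \<alpha> = assms(3)
  define n where "n = real CARD('n)"
  define a where "a = exp (2 * \<alpha> * real CARD('k2))"
  define b where "b = \<sigma>\<^sup>2 / \<alpha>"
  have n: "0 < n" and a: "0 < a" and b: "0 < b" using \<sigma> \<alpha> by (auto simp: n_def a_def b_def)
  define B where "B = whiten X"
  define C where "C = (1 / sqrt n) *\<^sub>R B"
  define \<mu> where "\<mu> = B *v \<beta>"
  have invB: "invertible B" unfolding B_def by (rule whiten_invertible[OF rk])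
  \<comment> \<open>The inverse of \<open>C\<close>: it undoes the whitening and restores the scale
    \<open>sqrt n\<close>.\<close>
  define Ci where "Ci = sqrt n *\<^sub>R matrix_inv B"
  have CiC: "C ** Ci = mat 1" "Ci ** C = mat 1"
    using matrix_inv[OF invB] n
    by (simp_all add: C_def Ci_def scalar_matrix_assoc[symmetric] matrix_scalar_ac)
  have gramC: "transpose C ** C = (1 / n) *\<^sub>R (transpose X ** X)"
  proof -
    have "transpose C = (1 / sqrt n) *\<^sub>R transpose B"
      by (simp add: C_def transpose_def vec_eq_iff)
    then show ?thesis
      using n whiten_gram[OF rk]
      by (simp add: C_def B_def scalar_matrix_assoc[symmetric] matrix_scalar_ac)
  qed
  \<comment> \<open>The determinant in the density is \<open>(det C)^2\<close>, so its root cancels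
    the Jacobian of the linear part \<open>Ci\<close>.\<close>
  have detC: "\<bar>det Ci\<bar> * sqrt (det ((1 / n) *\<^sub>R (transpose X ** X))) = 1"
  proof -
    have "det ((1 / n) *\<^sub>R (transpose X ** X)) = (det C)\<^sup>2"
      unfolding gramC[symmetric] det_mul by (simp add: power2_eq_square)
    moreover have "det Ci * det C = 1" using CiC(2) by (metis det_mul det_I)
    ultimately show ?thesis by (simp add: abs_mult[symmetric])
  qed
  \<comment> \<open>\<open>T\<close> takes the whitened least squares vector to the scaled
    estimation error, as \<open>T_tilde\<close> shows.\<close>
  define T where "T z = Ci *v shrink_map a b z - sqrt n *\<^sub>R \<beta>" for z
  have T_tilde: "sqrt (real CARD('n)) *\<^sub>R (beta_tilde \<alpha> \<sigma> X Y - \<beta>) = T (whitened_ls X *v Y)" for Y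
  proof -
    have "Ci *v (B *v beta_tilde \<alpha> \<sigma> X Y) = sqrt n *\<^sub>R ((matrix_inv B ** B) *v beta_tilde \<alpha> \<sigma> X Y)"
      unfolding Ci_def
      by (subst scaleR_matrix_vector_assoc[symmetric]) (simp only: matrix_vector_mul_assoc)
    also have "\<dots> = sqrt n *\<^sub>R beta_tilde \<alpha> \<sigma> X Y" by (simp add: matrix_inv[OF invB])
    finally show ?thesis
      unfolding T_def whitened_ls_mult[OF rk] using whiten_beta_tilde[OF rk \<sigma> \<alpha>, of Y]
      by (simp add: B_def a_def b_def n_def scaleR_diff_right)
  qed
  \<comment> \<open>Hence \<open>C t + \<mu>\<close> at \<open>t = T z\<close> is
    \<open>shrink_map a b z\<close>, which makes every term of \<open>dens\<close> at
    \<open>T z\<close> explicit in \<open>z\<close>.\<close>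
  have CT: "C *v T z = shrink_map a b z - \<mu>" for z
  proof -
    have "C *v (sqrt n *\<^sub>R \<beta>) = \<mu>"
      using n by (simp add: C_def \<mu>_def scaleR_matrix_vector_assoc[symmetric] matrix_vector_mult_scaleR)
    then show ?thesis
      by (simp add: T_def matrix_vector_mult_diff_distrib matrix_vector_mul_assoc CiC)
  qed
  have derT: "(T has_derivative (\<lambda>d. Ci *v shrink_deriv a b z d)) (at z)" for z
    unfolding T_def
    using has_derivative_diff[OF bounded_linear.has_derivative[OF matrix_vector_mul_bounded_linear
          shrink_map_has_derivative[OF a b]] has_derivative_const]
    by simp
  have injT: "inj T"
    using CT inj_shrink_map[OF a b] by (metis add_diff_cancel_right' diff_add_cancel injD injI)
  have surjT: "surj T"
  proof (unfold surj_def, rule allI)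
    fix t
    obtain z where "shrink_map a b z = C *v (t + sqrt n *\<^sub>R \<beta>)"
      using surj_shrink_map[OF a b] by (metis surjD)
    then have "T z = t" by (simp add: T_def matrix_vector_mul_assoc CiC)
    then show "\<exists>z. t = T z" by blast
  qed
  define p where "p z = (2 * pi * \<sigma>\<^sup>2) powr (- real CARD('k1+'k2) / 2) * exp (- (norm (z - \<mu>))\<^sup>2 / (2 * \<sigma>\<^sup>2))" for z
  have "distr (density lborel (\<lambda>z. ennreal (p z))) lborel T = density lborel (\<lambda>t. ennreal (dens \<alpha> \<sigma> X \<beta> t))"
  proof (rule distr_density_change_of_variables[OF derT injT surjT])
    show "integrable lborel p" unfolding p_def by (rule gauss_density_integrable[OF \<sigma>])
    show "0 \<le> p z" for z by (simp add: p_def)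
    have cont: "continuous_on UNIV (\<lambda>t. vpart1 (C *v t))" "continuous_on UNIV (\<lambda>t. vpart2 (C *v t + \<mu>))"
      by (intro continuous_intros linear_continuous_on_compose[OF _ bounded_linear.linear[OF bounded_linear_vpart1]]
         linear_continuous_on_compose[OF _ bounded_linear.linear[OF bounded_linear_vpart2]])+
    note [measurable] = cont[THEN borel_measurable_continuous_onI] borel_measurable_g_fun_norm[OF a b]
    show "dens \<alpha> \<sigma> X \<beta> \<in> borel_measurable borel"
      unfolding dens_eq[OF rk, abs_def] n_def[symmetric] a_def[symmetric] b_def[symmetric]
        B_def[symmetric] C_def[symmetric] \<mu>_def[symmetric]
      by measurable
    show "0 \<le> dens \<alpha> \<sigma> X \<beta> t" for t
    proof -
      have "0 \<le> det ((1 / n) *\<^sub>R (transpose X ** X))"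
        unfolding gramC[symmetric] det_mul by simp
      then show ?thesis
        unfolding dens_eq[OF rk] n_def[symmetric] using \<alpha> by (auto intro!: mult_nonneg_nonneg add_nonneg_nonneg)
    qed
    \<comment> \<open>What remains is the Jacobian identity at the image point \<open>T z\<close>,
      where \<open>g_fun\<close> returns the unshrunken radius.\<close>
    fix z :: "real^('k1+'k2)"
    define r where "r = (norm (vpart2 z))\<^sup>2"
    define s where "s = shrink a b r"
    define E where "E = a * exp (- r / b)"
    have E: "0 < E" "s = inverse (1 + E)" using a by (simp_all add: E_def s_def shrink_def)
    have s: "0 < s" using E by simp
    have "matrix (\<lambda>d. Ci *v shrink_deriv a b z d) = Ci ** matrix (shrink_deriv a b z)"
      using matrix_compose[of "shrink_deriv a b z" "(*v) Ci"] shrink_map_has_derivative[OF a b, of z]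
      by (simp add: o_def has_derivative_linear)
    then have det: "det (matrix (\<lambda>d. Ci *v shrink_deriv a b z d)) = det Ci * (s ^ CARD('k2) * (1 + 2 * (s * (E / b)) * r))"
      by (simp add: det_mul det_shrink_deriv[OF a b] r_def[symmetric] s_def E_def)
    have w: "vpart2 (C *v T z + \<mu>) = s *\<^sub>R vpart2 z"
      unfolding CT by (simp add: shrink_map_def[OF a b] s_def r_def)
    have G: "g_fun a b (norm (s *\<^sub>R vpart2 z)) = norm (vpart2 z)"
      unfolding s_def r_def norm_shrink_scaleR[OF a b] by (simp add: g_fun_h_fun[OF a b])
    have Gw: "(if s *\<^sub>R vpart2 z = 0 then 0 else (norm (vpart2 z) / norm (s *\<^sub>R vpart2 z)) *\<^sub>R (s *\<^sub>R vpart2 z)) = vpart2 z"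
      using shrink_left_inverse[OF a b, of "vpart2 z"] unfolding r_def[symmetric] s_def[symmetric] G .
    \<comment> \<open>The first block is not shrunk, so it contributes its Gaussian exponent
      directly; the second contribution is the one from \<open>Gw\<close>.\<close>
    have v: "(norm (z - \<mu>))\<^sup>2 = (norm (vpart1 (C *v T z)))\<^sup>2 + (norm (vpart2 z - vpart2 \<mu>))\<^sup>2"
    proof -
      obtain z1 z2 m1 m2 where "z = vjoin z1 z2" "\<mu> = vjoin m1 m2" by (metis vjoin_cases)
      then show ?thesis unfolding CT by (simp add: shrink_map_def[OF a b] vjoin_diff norm_vjoin)
    qed
    \<comment> \<open>Since \<open>a = exp (2 \<alpha> k2)\<close> and
      \<open>1/b = \<alpha>/\<sigma>^2\<close>, the exponential here is \<open>E\<close>, and the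
      one in \<open>e2\<close> is its reciprocal.\<close>
    have e1: "1 + exp (- \<alpha> / \<sigma>\<^sup>2 * r + 2 * \<alpha> * real CARD('k2)) = inverse s"
      by (simp add: E E_def a_def b_def mult_exp_exp algebra_simps)
    have e2: "exp (\<alpha> / \<sigma>\<^sup>2 * r - 2 * \<alpha> * real CARD('k2)) = inverse E"
      by (simp add: E_def a_def b_def mult_exp_exp exp_minus[symmetric] algebra_simps)
    have "inverse (1 + inverse E) = s * E" using E by (simp add: field_simps)
    then have e3: "1 + 2 * \<alpha> / \<sigma>\<^sup>2 * r * inverse (1 + exp (\<alpha> / \<sigma>\<^sup>2 * r - 2 * \<alpha> * real CARD('k2)))
        = 1 + 2 * (s * (E / b)) * r"
      unfolding e2 by (simp add: b_def)
    have pos: "0 < 1 + 2 * (s * (E / b)) * r"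
      using s E b by (intro add_pos_nonneg mult_nonneg_nonneg) (auto simp: r_def)
    have "dens \<alpha> \<sigma> X \<beta> (T z) = (2 * pi * \<sigma>\<^sup>2) powr (- real CARD('k1+'k2) / 2) * sqrt (det ((1 / n) *\<^sub>R (transpose X ** X)))
       * exp (- (norm (vpart1 (C *v T z)))\<^sup>2 / (2 * \<sigma>\<^sup>2))
       * inverse s ^ CARD('k2) * inverse (1 + 2 * (s * (E / b)) * r)
       * exp (- (norm (vpart2 z - vpart2 \<mu>))\<^sup>2 / (2 * \<sigma>\<^sup>2))"
      unfolding dens_eq[OF rk] n_def[symmetric] a_def[symmetric] b_def[symmetric]
        B_def[symmetric] C_def[symmetric] \<mu>_def[symmetric] w G Gw r_def[symmetric] e1 e3 ..
    also have "exp (- (norm (vpart1 (C *v T z)))\<^sup>2 / (2 * \<sigma>\<^sup>2)) = exp (- (norm (z - \<mu>))\<^sup>2 / (2 * \<sigma>\<^sup>2)) / exp (- (norm (vpart2 z - vpart2 \<mu>))\<^sup>2 / (2 * \<sigma>\<^sup>2))"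
      unfolding v exp_diff[symmetric] by (simp add: diff_divide_distrib)
    finally have D: "dens \<alpha> \<sigma> X \<beta> (T z) = p z * sqrt (det ((1 / n) *\<^sub>R (transpose X ** X)))
       * inverse s ^ CARD('k2) * inverse (1 + 2 * (s * (E / b)) * r)"
      by (simp add: p_def)
    have "\<bar>det (matrix (\<lambda>d. Ci *v shrink_deriv a b z d))\<bar> * dens \<alpha> \<sigma> X \<beta> (T z)
       = (\<bar>det Ci\<bar> * sqrt (det ((1 / n) *\<^sub>R (transpose X ** X)))) * (s ^ CARD('k2) * inverse s ^ CARD('k2))
         * ((1 + 2 * (s * (E / b)) * r) * inverse (1 + 2 * (s * (E / b)) * r)) * p z"
      unfolding D det using s pos by (simp add: abs_mult abs_of_pos)
    also have "\<dots> = p z"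
      unfolding detC using s pos by (simp add: power_inverse)
    finally show "\<bar>det (matrix (\<lambda>d. Ci *v shrink_deriv a b z d))\<bar> * dens \<alpha> \<sigma> X \<beta> (T z) = p z" .
  qed
  then have push: "distr (gauss \<mu> \<sigma>) lborel T = density lborel (\<lambda>t. ennreal (dens \<alpha> \<sigma> X \<beta> t))"
    by (simp add: gauss_def p_def)
  have "continuous_on UNIV T"
    using derT by (meson continuous_at_imp_continuous_on has_derivative_continuous)
  then have [measurable]: "T \<in> borel_measurable borel" by (rule borel_measurable_continuous_onI)
  \<comment> \<open>The law of \<open>Y\<close> is pushed through the linear map first, where it
    stays Gaussian, and then through \<open>T\<close>.\<close>
  have "distr (model_distr X \<beta> \<sigma>) lborel (\<lambda>Y. sqrt (real CARD('n)) *\<^sub>R (beta_tilde \<alpha> \<sigma> X Y - \<beta>))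
      = distr (gauss (X *v \<beta>) \<sigma>) lborel (T \<circ> (*v) (whitened_ls X))"
    by (simp add: T_tilde o_def model_distr_def gauss_def)
  also have "\<dots> = distr (distr (gauss (X *v \<beta>) \<sigma>) borel ((*v) (whitened_ls X))) lborel T"
    by (rule distr_distr[symmetric])
      (auto simp: measurable_cong_sets[OF sets_gauss refl] intro!: borel_measurable_continuous_onI continuous_intros)
  also have "distr (gauss (X *v \<beta>) \<sigma>) borel ((*v) (whitened_ls X)) = gauss \<mu> \<sigma>"
    using distr_gauss_linear[OF \<sigma> whitened_ls_orthonormal[OF rk]] whitened_ls_mean[OF rk]
    by (simp add: \<mu>_def B_def)
  finally show ?thesis using push by simp
qed

end
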